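(* Let $A \in M_n$ and let $k$ be an integer with $1 \le k \le n$. Then the rank-$k$ numerical range $\Lambda_k(A)$ is a convex subset of $\mathbb{C}$.
   Context: $M_n$ is the algebra of $n\times n$ complex matrices. The rank-$k$ numerical range of $A \in M_n$ is $$\Lambda_k(A) = \{\lambda \in \mathbb{C} : PAP = \lambda P \text{ for some rank-}k \text{ orthogonal projection } P \in M_n\}.$$ The empty set is regarded as convex. *)

theory Defs
  imports
    "HOL-Analysis.Convex"
    "Jordan_Normal_Form.Schur_Decomposition"
    "Jordan_Normal_Form.DL_Rank"
begin

definition orthogonal_projection_mat :: "nat \<Rightarrow> complex mat \<Rightarrow> bool" where
  "orthogonal_projection_mat n P \<longleftrightarrow>
     P \<in> carrier_mat n n \<and> P * P = P \<and> mat_adjoint P = P"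

text \<open>The ambient dimension \<open>n\<close> is an explicit argument because the rank of a matrix is
  defined relative to the space of vectors of length \<open>n\<close>; it is meant for
  \<open>A \<in> carrier_mat n n\<close>.\<close>

definition rank_numerical_range :: "nat \<Rightarrow> nat \<Rightarrow> complex mat \<Rightarrow> complex set" where
  "rank_numerical_range n k A =
     {z. \<exists>P. orthogonal_projection_mat n P \<and> vec_space.rank n P = k \<and> P * A * P = z \<cdot>\<^sub>m P}"

end

theory Submission
  imports Defs
begin

text \<open>
  A scalar z lies in the rank-k numerical range of A iff the sesquilinear form of A - z vanishes on
  some k-dimensional subspace. If \<open>\<alpha>\<close> and \<open>\<beta>\<close> are distinct members and z lies strictly between them,
  then a suitable multiple C of A - z is positive definite on a k-dimensional space S and negative
  definite on a k-dimensional space T, and it is enough to find an isotropic subspace of dimension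
  k inside the 2k-dimensional space S + T.

  Write the form of C on S + T as \<open>H + \<i> G\<close> with H and G Hermitian, and let D be the
  involution that is 1 on S and -1 on T. Then D H + H D is positive definite while D G + G D = 0, so
  \<open>H x = \<mu> G x\<close> has no nonzero solution with \<open>\<mu>\<close> real. If G is invertible, all 2k eigenvalues of
  \<open>G\<^sup>-\<^sup>1 H\<close> are therefore nonreal, and k of them lie in one open half plane. A Schur
  decomposition listing these first gives an invariant subspace W on which
  \<open>G\<^sup>-\<^sup>1 H\<close> acts by a triangular matrix R, and the Gram matrix M of G on W satisfies
  \<open>R\<^sup>* M = M R\<close>. The spectra of \<open>R\<^sup>*\<close> and R are disjoint, hence M = 0 and W is isotropic for G and
  for H. A singular G is perturbed, and compactness of the set of rank-k orthogonal projections
  yields the limit.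
\<close>

section \<open>Adjoints, Gram matrices and traces\<close>

lemma dim_mat_adjoint [simp]:
  "dim_row (mat_adjoint A) = dim_col A" "dim_col (mat_adjoint A) = dim_row A"
  by (simp_all add: mat_adjoint_def)

lemma mat_adjoint_carrier [simp]: "A \<in> carrier_mat n m \<Longrightarrow> mat_adjoint A \<in> carrier_mat m n"
  unfolding carrier_mat_def by simp

lemma index_mat_adjoint [simp]:
  "i < dim_col A \<Longrightarrow> j < dim_row A \<Longrightarrow> mat_adjoint A $$ (i, j) = conjugate (A $$ (j, i))"
  by (simp add: mat_adjoint_def mat_of_rows_index)

lemma index_mult_mat_sum:
  "i < dim_row A \<Longrightarrow> j < dim_col B \<Longrightarrow> dim_col A = dim_row B \<Longrightarrow>
    (A * B) $$ (i, j) = (\<Sum>l<dim_row B. A $$ (i, l) * B $$ (l, j))"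
  by (simp add: scalar_prod_def lessThan_atLeast0)

text \<open>This and the next laws take equations between dimensions as premises: the simplifier
  decides these by computation, whereas carrier premises contain dimensions that the left-hand side
  does not determine.\<close>

lemma mult_assoc_dim:
  fixes A B C :: "'a :: semiring_0 mat"
  shows "dim_col A = dim_row B \<Longrightarrow> dim_col B = dim_row C \<Longrightarrow> A * B * C = A * (B * C)"
  by (rule assoc_mult_mat) auto

lemma add_mult_distrib_dim:
  fixes A B C :: "'a :: semiring_0 mat"
  shows "dim_row A = dim_row B \<Longrightarrow> dim_col A = dim_col B \<Longrightarrow> dim_col A = dim_row C \<Longrightarrow>
    (A + B) * C = A * C + B * C"
  by (rule add_mult_distrib_mat) auto

lemma mult_add_distrib_dim:
  fixes A B C :: "'a :: semiring_0 mat"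
  shows "dim_row B = dim_row C \<Longrightarrow> dim_col B = dim_col C \<Longrightarrow> dim_col A = dim_row B \<Longrightarrow>
    A * (B + C) = A * B + A * C"
  by (rule mult_add_distrib_mat) auto

lemma mult_smult_dim:
  fixes A B :: "'a :: comm_semiring_0 mat"
  shows "dim_col A = dim_row B \<Longrightarrow> A * (c \<cdot>\<^sub>m B) = c \<cdot>\<^sub>m (A * B)"
    "dim_col A = dim_row B \<Longrightarrow> (c \<cdot>\<^sub>m A) * B = c \<cdot>\<^sub>m (A * B)"
  by (rule mult_smult_distrib mult_smult_assoc_mat; auto)+

lemmas mat_ring_simps = mult_assoc_dim add_mult_distrib_dim mult_add_distrib_dim mult_smult_dim

lemma mat_adjoint_adjoint [simp]: "mat_adjoint (mat_adjoint A) = (A :: complex mat)"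
  by (rule eq_matI) auto

lemma mat_adjoint_mult:
  "dim_col A = dim_row B \<Longrightarrow> mat_adjoint (A * B) = mat_adjoint B * mat_adjoint (A :: complex mat)"
  by (rule eq_matI) (auto simp: index_mult_mat_sum mult.commute simp del: index_mult_mat(1))

lemma mat_adjoint_add:
  "dim_row A = dim_row B \<Longrightarrow> dim_col A = dim_col B \<Longrightarrow>
    mat_adjoint (A + B) = mat_adjoint A + mat_adjoint (B :: complex mat)"
  by (rule eq_matI) auto

lemma mat_adjoint_smult: "mat_adjoint (c \<cdot>\<^sub>m A) = cnj c \<cdot>\<^sub>m mat_adjoint (A :: complex mat)"
  by (rule eq_matI) auto

lemma mat_adjoint_one [simp]: "mat_adjoint (1\<^sub>m n) = (1\<^sub>m n :: complex mat)"
  by (rule eq_matI) auto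

lemmas mat_adjoint_simps = mat_adjoint_mult mat_adjoint_add mat_adjoint_smult

lemma adjoint_mult_self_diag:
  fixes X :: "complex mat"
  assumes "j < dim_col X"
  shows "(mat_adjoint X * X) $$ (j, j) = (\<Sum>i<dim_row X. of_real ((cmod (X $$ (i, j)))\<^sup>2))"
proof -
  have "(mat_adjoint X * X) $$ (j, j) = (\<Sum>i<dim_row X. cnj (X $$ (i, j)) * X $$ (i, j))"
    using assms by (simp add: index_mult_mat_sum del: index_mult_mat(1))
  also have "\<dots> = (\<Sum>i<dim_row X. of_real ((cmod (X $$ (i, j)))\<^sup>2))"
    by (intro sum.cong refl) (simp only: complex_norm_square mult.commute)
  finally show ?thesis .
qed

text \<open>The diagonal entries of the Gram matrix are the squared norms of the columns of
  \<open>X\<close>, so the diagonal alone already forces \<open>X\<close> to vanish.\<close>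

lemma adjoint_mult_self_eq_0:
  fixes X :: "complex mat"
  assumes "mat_adjoint X * X = 0\<^sub>m (dim_col X) (dim_col X)"
  shows "X = 0\<^sub>m (dim_row X) (dim_col X)"
proof (rule eq_matI)
  fix i j assume ij: "i < dim_row (0\<^sub>m (dim_row X) (dim_col X) :: complex mat)"
    "j < dim_col (0\<^sub>m (dim_row X) (dim_col X) :: complex mat)"
  have "of_real (\<Sum>i<dim_row X. (cmod (X $$ (i, j)))\<^sup>2) = (0 :: complex)"
    using adjoint_mult_self_diag[of j X] assms ij by simp
  hence "(\<Sum>i<dim_row X. (cmod (X $$ (i, j)))\<^sup>2) = 0"
    using of_real_eq_0_iff by blast
  thus "X $$ (i, j) = 0\<^sub>m (dim_row X) (dim_col X) $$ (i, j)"
    using ij by (simp add: sum_nonneg_eq_0_iff)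
qed auto

text \<open>Vectors are encoded as matrices with one column, so that adjoints and matrix products suffice.\<close>

lemma mult_col_mat_eq_0_iff:
  fixes A :: "'a :: field mat"
  assumes "A \<in> carrier_mat n n"
  shows "det A = 0 \<longleftrightarrow> (\<exists>X \<in> carrier_mat n 1. X \<noteq> 0\<^sub>m n 1 \<and> A * X = 0\<^sub>m n 1)"
proof -
  have bij: "mat_of_cols n [v] \<in> carrier_mat n 1 \<and> (mat_of_cols n [v] = 0\<^sub>m n 1 \<longleftrightarrow> v = 0\<^sub>v n) \<and>
     (A * mat_of_cols n [v] = 0\<^sub>m n 1 \<longleftrightarrow> A *\<^sub>v v = 0\<^sub>v n)" if "v \<in> carrier_vec n" for v
  proof -
    have c: "col (mat_of_cols n [v]) 0 = v" using that by (simp add: col_mat_of_cols)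
    show ?thesis using that assms c
      by (auto simp: mat_eq_iff vec_eq_iff mat_of_cols_index)
  qed
  have sur: "X = mat_of_cols n [col X 0]" if "X \<in> carrier_mat n 1" for X :: "'a mat"
    using that by (auto simp: mat_eq_iff mat_of_cols_index)
  have "(\<exists>v. v \<in> carrier_vec n \<and> v \<noteq> 0\<^sub>v n \<and> A *\<^sub>v v = 0\<^sub>v n) \<longleftrightarrow>
      (\<exists>X \<in> carrier_mat n 1. X \<noteq> 0\<^sub>m n 1 \<and> A * X = 0\<^sub>m n 1)" (is "?l \<longleftrightarrow> ?r")
  proof
    assume ?l
    then show ?r using bij by blast
  next
    assume ?r
    then obtain X where X: "X \<in> carrier_mat n 1" "X \<noteq> 0\<^sub>m n 1" "A * X = 0\<^sub>m n 1" by blast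
    define v where "v = col X 0"
    have v: "v \<in> carrier_vec n" unfolding v_def using X(1) by (intro carrier_vecI) simp
    have Xv: "X = mat_of_cols n [v]" unfolding v_def by (rule sur[OF X(1)])
    note b = bij[OF v, folded Xv]
    have "v \<noteq> 0\<^sub>v n" "A *\<^sub>v v = 0\<^sub>v n" using b X(2,3) by blast+
    with v show ?l by blast
  qed
  thus ?thesis unfolding det_0_iff_vec_prod_zero_field[OF assms] .
qed

lemma injective_mat_inverse:
  fixes A :: "'a :: field mat"
  assumes A: "A \<in> carrier_mat n n"
    and "\<And>X. X \<in> carrier_mat n 1 \<Longrightarrow> A * X = 0\<^sub>m n 1 \<Longrightarrow> X = 0\<^sub>m n 1"
  obtains B where "B \<in> carrier_mat n n" "B * A = 1\<^sub>m n" "A * B = 1\<^sub>m n"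
proof -
  have "det A \<noteq> 0" using assms mult_col_mat_eq_0_iff[OF A] by blast
  \<comment> \<open>A unit of the matrix ring is a matrix with a two-sided inverse;
    \<open>()\<close> fills the extension slot of the ring record.\<close>
  from det_non_zero_imp_unit[OF A this, of "()"] show thesis
    using that unfolding Units_def by (auto simp: ring_mat_def)
qed

definition mat_trace :: "'a :: comm_monoid_add mat \<Rightarrow> 'a" where
  "mat_trace A = (\<Sum>i<dim_row A. A $$ (i, i))"

lemma mat_trace_mult_commute:
  fixes A B :: "'a :: comm_semiring_0 mat"
  assumes "dim_col A = dim_row B" "dim_col B = dim_row A"
  shows "mat_trace (A * B) = mat_trace (B * A)"
proof -
  have "mat_trace (A * B) = (\<Sum>i<dim_row A. \<Sum>l<dim_row B. A $$ (i, l) * B $$ (l, i))"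
    using assms by (simp add: mat_trace_def index_mult_mat_sum del: index_mult_mat(1))
  also have "\<dots> = (\<Sum>l<dim_row B. \<Sum>i<dim_row A. B $$ (l, i) * A $$ (i, l))"
    by (subst sum.swap) (simp add: mult.commute)
  also have "\<dots> = mat_trace (B * A)"
    using assms by (simp add: mat_trace_def index_mult_mat_sum del: index_mult_mat(1))
  finally show ?thesis .
qed

lemma mat_trace_one [simp]: "mat_trace (1\<^sub>m n) = (of_nat n :: complex)"
  unfolding mat_trace_def by simp

section \<open>Rank of idempotent matrices\<close>

context vec_space
begin

text \<open>A vector of \<open>S\<close> outside \<open>span U\<close> could be added to
  \<open>U\<close> without destroying independence, against maximality.\<close>

lemma maximal_indpt_span:
  assumes "finite S" "S \<subseteq> carrier_vec n" "maximal U (\<lambda>T. T \<subseteq> S \<and> lin_indpt T)"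
  shows "S \<subseteq> span U"
proof
  fix s assume s: "s \<in> S"
  have U: "U \<subseteq> S" "lin_indpt U" using assms(3) unfolding maximal_def by auto
  show "s \<in> span U"
  proof (rule ccontr)
    assume ns: "s \<notin> span U"
    have UC: "U \<subseteq> carrier_vec n" using U assms by auto
    have "s \<notin> U" using ns in_own_span[OF UC] by auto
    hence "lin_indpt (U \<union> {s})"
      using lin_dep_iff_in_span[OF UC U(2), of s] ns s assms by auto
    hence "U \<union> {s} = U" using assms(3) s U unfolding maximal_def by blast
    thus False using \<open>s \<notin> U\<close> by auto
  qed
qed

end

text \<open>\<open>V\<close> lists a maximal independent set of columns of \<open>P\<close>, a basis
  of the range, and \<open>Y\<close> holds the coordinates of all columns of \<open>P\<close> in it.
  As \<open>P\<close> fixes its range, \<open>V * Y * V = V\<close>, and cancelling the injective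
  \<open>V\<close> leaves the identity.\<close>

lemma idempotent_rank_factorization:
  fixes P :: "'a :: field mat"
  assumes P: "P \<in> carrier_mat n n" and idem: "P * P = P"
  defines "r \<equiv> vec_space.rank n P"
  obtains V Y where "V \<in> carrier_mat n r" "Y \<in> carrier_mat r n" "P = V * Y" "Y * V = 1\<^sub>m r"
proof -
  interpret vec_space "TYPE('a)" n .
  have cP: "set (cols P) \<subseteq> carrier_vec n" using cols_dim[of P] P by auto
  obtain S where S: "finite S" "maximal S (\<lambda>T. T \<subseteq> set (cols P) \<and> lin_indpt T)"
    using maximal_exists_superset[of "set (cols P)" "\<lambda>T. T \<subseteq> set (cols P) \<and> lin_indpt T" "{}"]
      by (auto simp: lin_dep_def)
  have SP: "S \<subseteq> set (cols P)" "lin_indpt S" using S(2) unfolding maximal_def by auto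
  obtain vs where vs: "set vs = S" "distinct vs" using finite_distinct_list[OF S(1)] by auto
  have len: "length vs = r"
    using rank_card_indpt[OF P S(2)] vs distinct_card[OF vs(2)] unfolding r_def by simp
  define V where "V = mat_of_cols n vs"
  have V: "V \<in> carrier_mat n r" unfolding V_def using len by auto
  have cV: "cols V = vs" unfolding V_def using cP SP vs by (intro cols_mat_of_cols) auto
  have colV: "col V j \<in> S" if "j < r" for j
    using that V cV vs by (metis carrier_matD(2) cols_length cols_nth nth_mem)
  have "\<exists>y. y \<in> carrier_vec r \<and> V *\<^sub>v y = col P j" if j: "j < n" for j
  proof -
    have "col P j \<in> set (cols P)" using P j
      by (metis carrier_matD(2) cols_length cols_nth nth_mem)
    hence "col P j \<in> span S" using maximal_indpt_span[OF finite_set cP S(2)] by blast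
    moreover have "S \<subseteq> carrier_vec n" using SP cP by blast
    ultimately obtain a where "col P j = lincomb a S"
      using finite_span[OF S(1)] by auto
    also have "\<dots> = V *\<^sub>v vec r (\<lambda>i. a (col V i))"
      using mat_mult_eq_lincomb[OF V, of a] cV vs by simp
    finally show ?thesis by (intro exI[of _ "vec r (\<lambda>i. a (col V i))"]) auto
  qed
  then obtain y where y: "\<And>j. j < n \<Longrightarrow> y j \<in> carrier_vec r \<and> V *\<^sub>v y j = col P j" by metis
  define Y where "Y = mat_of_cols r (map y [0..<n])"
  have Y: "Y \<in> carrier_mat r n" unfolding Y_def by auto
  have colY: "col Y j = y j" if "j < n" for j
    unfolding Y_def using that y by (subst col_mat_of_cols) auto
  have PVY: "P = V * Y"
  proof (rule mat_col_eqI)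
    fix j assume "j < dim_col (V * Y)"
    hence j: "j < n" using Y by auto
    show "col P j = col (V * Y) j" using col_mult2[OF V Y j] colY[OF j] y[OF j] by simp
  qed (use P V Y in auto)
  have PV: "P * V = V"
  proof (rule mat_col_eqI)
    fix j assume "j < dim_col V"
    hence j: "j < r" using V by auto
    obtain i where i: "i < n" "col V j = col P i"
      using colV[OF j] SP(1) P by (metis carrier_matD(2) cols_length cols_nth in_set_conv_nth subsetD)
    have "col (P * V) j = P *\<^sub>v col P i" using col_mult2[OF P V j] i by simp
    also have "\<dots> = col (P * P) i" using col_mult2[OF P P i(1)] by simp
    finally show "col (P * V) j = col V j" using idem i by simp
  qed (use P V in auto)
  have YV1: "Y * V = 1\<^sub>m r"
  proof (rule mat_col_eqI)
    fix j assume "j < dim_col (1\<^sub>m r :: 'a mat)"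
    hence j: "j < r" by auto
    \<comment> \<open>\<open>V\<close> maps both vectors to its column \<open>j\<close>, so it kills
      \<open>w\<close>, and the independence of its columns gives \<open>w = 0\<close>.\<close>
    define w where "w = col (Y * V) j - unit_vec r j"
    have YVc: "Y * V \<in> carrier_mat r r" using Y V by auto
    have u: "col (Y * V) j \<in> carrier_vec r" using YVc by (intro carrier_vecI) auto
    have w: "w \<in> carrier_vec r" unfolding w_def using u by simp
    have "V *\<^sub>v col (Y * V) j = col V j"
      using col_mult2[OF V YVc j] PV assoc_mult_mat[OF V Y V] PVY by metis
    moreover have "V *\<^sub>v unit_vec r j = col V j"
      using V j by (metis col_mult2 col_one one_carrier_mat right_mult_one_mat)
    ultimately have "V *\<^sub>v w = 0\<^sub>v n"
      unfolding w_def using V u j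
      by (subst mult_minus_distrib_mat_vec[of _ n r]) (auto intro!: minus_cancel_vec)
    hence "w = 0\<^sub>v r"
      using lin_depI[OF V w] cV vs SP(2) by auto
    have "col (Y * V) j = unit_vec r j"
    proof (rule eq_vecI)
      fix i assume "i < dim_vec (unit_vec r j :: 'a vec)"
      hence i: "i < r" by simp
      have "w $ i = 0" using \<open>w = 0\<^sub>v r\<close> i by simp
      thus "col (Y * V) j $ i = unit_vec r j $ i" using i u unfolding w_def by simp
    qed (use Y u in auto)
    thus "col (Y * V) j = col (1\<^sub>m r) j" using j by simp
  qed (use Y V in auto)
  show thesis by (rule that[OF V Y PVY YV1])
qed

text \<open>The trace is cyclic, so \<open>P = V * Y\<close> has the trace of \<open>Y * V\<close>,
  an identity matrix whose size is the rank. The trace is continuous in the entries, which lets the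
  rank survive limits.\<close>

lemma idempotent_rank_eq_trace:
  fixes P :: "complex mat"
  assumes "P \<in> carrier_mat n n" "P * P = P"
  shows "mat_trace P = of_nat (vec_space.rank n P)"
proof -
  obtain V Y where VY: "V \<in> carrier_mat n (vec_space.rank n P)" "Y \<in> carrier_mat (vec_space.rank n P) n"
    "P = V * Y" "Y * V = 1\<^sub>m (vec_space.rank n P)"
    using idempotent_rank_factorization[OF assms] .
  have "mat_trace P = mat_trace (Y * V)"
    unfolding VY(3) using VY(1,2) by (intro mat_trace_mult_commute) auto
  thus ?thesis by (simp add: VY(4))
qed

section \<open>Isotropic subspaces and the numerical range\<close>

text \<open>The left inverse \<open>Y\<close> expresses that the \<open>k\<close> columns of \<open>V\<close> are linearly independent.\<close>

definition isotropic :: "nat \<Rightarrow> nat \<Rightarrow> complex mat \<Rightarrow> bool" where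
  "isotropic n k B \<longleftrightarrow> (\<exists>V \<in> carrier_mat n k. (\<exists>Y \<in> carrier_mat k n. Y * V = 1\<^sub>m k) \<and>
     mat_adjoint V * B * V = 0\<^sub>m k k)"

lemma isotropicI:
  "V \<in> carrier_mat n k \<Longrightarrow> Y \<in> carrier_mat k n \<Longrightarrow> Y * V = 1\<^sub>m k \<Longrightarrow>
    mat_adjoint V * B * V = 0\<^sub>m k k \<Longrightarrow> isotropic n k B"
  unfolding isotropic_def by blast

lemma isotropicE:
  assumes "isotropic n k B"
  obtains V Y where "V \<in> carrier_mat n k" "Y \<in> carrier_mat k n" "Y * V = 1\<^sub>m k"
    "mat_adjoint V * B * V = 0\<^sub>m k k"
  using assms unfolding isotropic_def by blast

lemma mult_left_inverse_cancel:
  fixes V :: "complex mat"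
  assumes "V \<in> carrier_mat n k" "Y \<in> carrier_mat k n" "Y * V = 1\<^sub>m k" "X \<in> carrier_mat k l"
    "V * X = 0\<^sub>m n l"
  shows "X = 0\<^sub>m k l"
proof -
  have "X = Y * V * X" using assms by simp
  also have "\<dots> = Y * (V * X)" using assms(1,2,4) by (simp add: mult_assoc_dim)
  finally show ?thesis using assms by simp
qed

text \<open>The Gram matrix has trivial kernel because
  \<open>mat_adjoint X * (mat_adjoint V * V * X)\<close> is the Gram matrix of \<open>V * X\<close>.
  Its inverse is self-adjoint because \<open>mat_adjoint N\<close> is a left inverse of the same
  matrix.\<close>

lemma gram_inverse:
  fixes V :: "complex mat"
  assumes V: "V \<in> carrier_mat n k"
    and inj: "\<And>X. X \<in> carrier_mat k 1 \<Longrightarrow> V * X = 0\<^sub>m n 1 \<Longrightarrow> X = 0\<^sub>m k 1"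
  obtains N where "N \<in> carrier_mat k k" "N * (mat_adjoint V * V) = 1\<^sub>m k"
    "mat_adjoint V * V * N = 1\<^sub>m k" "mat_adjoint N = N"
proof -
  let ?M = "mat_adjoint V * V"
  have M: "?M \<in> carrier_mat k k" using V by auto
  have "X = 0\<^sub>m k 1" if X: "X \<in> carrier_mat k 1" "?M * X = 0\<^sub>m k 1" for X
  proof -
    have "mat_adjoint (V * X) * (V * X) = mat_adjoint X * (?M * X)"
      using V X(1) by (simp add: mat_adjoint_mult mult_assoc_dim)
    hence "V * X = 0\<^sub>m n 1"
      using adjoint_mult_self_eq_0[of "V * X"] V X by simp
    thus ?thesis using inj X by blast
  qed
  then obtain N where N: "N \<in> carrier_mat k k" "N * ?M = 1\<^sub>m k" "?M * N = 1\<^sub>m k"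
    using injective_mat_inverse[OF M] by metis
  have "mat_adjoint (?M * N) = mat_adjoint N * ?M"
    using V N(1) by (simp add: mat_adjoint_mult)
  hence aN: "mat_adjoint N * ?M = 1\<^sub>m k" using N by simp
  have "mat_adjoint N = mat_adjoint N * (?M * N)" using N by simp
  also have "\<dots> = mat_adjoint N * ?M * N" using V N(1) by (simp add: mult_assoc_dim)
  also have "\<dots> = N" using aN N by simp
  finally show thesis using that N by blast
qed

text \<open>For injective \<open>V\<close> the inverse \<open>N\<close> of its Gram matrix supplies
  the left inverse \<open>N * mat_adjoint V\<close>, so no explicit witness has to be given.\<close>

lemma isotropic_injectiveI:
  assumes V: "V \<in> carrier_mat n k"
    and inj: "\<And>X. X \<in> carrier_mat k 1 \<Longrightarrow> V * X = 0\<^sub>m n 1 \<Longrightarrow> X = 0\<^sub>m k 1"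
    and "mat_adjoint V * B * V = 0\<^sub>m k k"
  shows "isotropic n k B"
proof -
  obtain N where "N \<in> carrier_mat k k" "N * (mat_adjoint V * V) = 1\<^sub>m k"
    using gram_inverse[OF V inj] by metis
  thus ?thesis using V assms(3)
    by (intro isotropicI[of V n k "N * mat_adjoint V"]) (auto simp: mult_assoc_dim)
qed

text \<open>Forwards, \<open>V * (N * mat_adjoint V)\<close>, with \<open>N\<close> the inverse Gram
  matrix, projects orthogonally onto the span of the columns of \<open>V\<close>, and its rank is
  computed as a trace. Backwards, factoring \<open>P = V * Y\<close> gives \<open>P * V = V\<close>,
  so the form on \<open>V\<close> is obtained from \<open>P * B * P\<close>.\<close>

lemma isotropic_iff_projection:
  assumes B: "B \<in> carrier_mat n n"
  shows "isotropic n k B \<longleftrightarrow>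
    (\<exists>P. orthogonal_projection_mat n P \<and> vec_space.rank n P = k \<and> P * B * P = 0\<^sub>m n n)"
proof
  assume "isotropic n k B"
  then obtain V Y where VY: "V \<in> carrier_mat n k" "Y \<in> carrier_mat k n" "Y * V = 1\<^sub>m k"
    and iso: "mat_adjoint V * B * V = 0\<^sub>m k k" by (rule isotropicE)
  note V = VY(1)
  obtain N where N: "N \<in> carrier_mat k k" "N * (mat_adjoint V * V) = 1\<^sub>m k"
    "mat_adjoint V * V * N = 1\<^sub>m k" "mat_adjoint N = N"
    using gram_inverse[OF V] mult_left_inverse_cancel[OF VY] by metis
  define P where "P = V * (N * mat_adjoint V)"
  have P: "P \<in> carrier_mat n n" unfolding P_def using V N(1) by auto
  have "P * P = V * (N * (mat_adjoint V * V) * (N * mat_adjoint V))"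
    unfolding P_def using V N(1) by (simp add: mult_assoc_dim)
  hence idem: "P * P = P" unfolding N(2) P_def using V N(1) by simp
  have sa: "mat_adjoint P = P"
    unfolding P_def using V N(1,4) by (simp add: mat_adjoint_mult mult_assoc_dim)
  have "mat_trace P = mat_trace (N * mat_adjoint V * V)"
    unfolding P_def using V N(1) by (intro mat_trace_mult_commute) auto
  also have "\<dots> = of_nat k" using V N(1,2) by (simp add: mult_assoc_dim)
  finally have "vec_space.rank n P = k"
    unfolding idempotent_rank_eq_trace[OF P idem] by simp
  moreover have "P * B * P = V * N * (mat_adjoint V * B * V) * (N * mat_adjoint V)"
    unfolding P_def using V N(1) B by (simp add: mult_assoc_dim)
  hence "P * B * P = 0\<^sub>m n n" unfolding iso using V N(1) by simp
  ultimately show "\<exists>P. orthogonal_projection_mat n P \<and> vec_space.rank n P = k \<and> P * B * P = 0\<^sub>m n n"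
    unfolding orthogonal_projection_mat_def using P idem sa by blast
next
  assume "\<exists>P. orthogonal_projection_mat n P \<and> vec_space.rank n P = k \<and> P * B * P = 0\<^sub>m n n"
  then obtain P where P: "P \<in> carrier_mat n n" "P * P = P" "mat_adjoint P = P"
    "vec_space.rank n P = k" "P * B * P = 0\<^sub>m n n"
    unfolding orthogonal_projection_mat_def by blast
  obtain V Y where VY: "V \<in> carrier_mat n k" "Y \<in> carrier_mat k n" "P = V * Y" "Y * V = 1\<^sub>m k"
    using idempotent_rank_factorization[OF P(1,2)] unfolding P(4) by metis
  have PV: "P * V = V" using VY(1,2,4) unfolding VY(3) by (simp add: mult_assoc_dim)
  have "mat_adjoint V * B * V = mat_adjoint (P * V) * B * (P * V)" unfolding PV ..
  also have "\<dots> = mat_adjoint V * (P * B * P) * V"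
    using P(1,3) VY(1) B by (simp add: mat_adjoint_mult mult_assoc_dim)
  finally show "isotropic n k B"
    unfolding P(5) using VY by (intro isotropicI[of V n k Y]) simp_all
qed

text \<open>An idempotent \<open>P\<close> compresses the shifted matrix to \<open>P * A * P\<close>
  minus \<open>z\<close> times \<open>P\<close>. The shift is written as a sum with a multiple by
  \<open>- z\<close> to fit the ring laws above, which treat sums and multiples.\<close>

lemma rank_numerical_range_iff_isotropic:
  assumes A: "A \<in> carrier_mat n n"
  shows "z \<in> rank_numerical_range n k A \<longleftrightarrow> isotropic n k (A + (- z) \<cdot>\<^sub>m 1\<^sub>m n)"
proof -
  have "P * A * P = z \<cdot>\<^sub>m P \<longleftrightarrow> P * (A + (- z) \<cdot>\<^sub>m 1\<^sub>m n) * P = 0\<^sub>m n n"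
    if P: "P \<in> carrier_mat n n" "P * P = P" for P
  proof -
    have "P * (A + (- z) \<cdot>\<^sub>m 1\<^sub>m n) * P = P * A * P + (- z) \<cdot>\<^sub>m P"
      using P A by (simp add: mat_ring_simps)
    moreover have "P * A * P + (- z) \<cdot>\<^sub>m P = 0\<^sub>m n n \<longleftrightarrow> P * A * P = z \<cdot>\<^sub>m P"
    proof
      assume eq: "P * A * P + (- z) \<cdot>\<^sub>m P = 0\<^sub>m n n"
      show "P * A * P = z \<cdot>\<^sub>m P"
      proof (rule eq_matI)
        fix i j assume "i < dim_row (z \<cdot>\<^sub>m P)" "j < dim_col (z \<cdot>\<^sub>m P)"
        moreover have "(P * A * P + (- z) \<cdot>\<^sub>m P) $$ (i, j) = (0\<^sub>m n n :: complex mat) $$ (i, j)"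
          unfolding eq ..
        ultimately show "(P * A * P) $$ (i, j) = (z \<cdot>\<^sub>m P) $$ (i, j)"
          using P(1) by (simp del: index_mult_mat(1))
      qed (use P(1) in auto)
    next
      assume eq: "P * A * P = z \<cdot>\<^sub>m P"
      show "P * A * P + (- z) \<cdot>\<^sub>m P = 0\<^sub>m n n"
        unfolding eq using P(1) by (intro eq_matI) auto
    qed
    ultimately show ?thesis by simp
  qed
  moreover have "A + (- z) \<cdot>\<^sub>m 1\<^sub>m n \<in> carrier_mat n n" using A by simp
  ultimately show ?thesis
    unfolding rank_numerical_range_def isotropic_iff_projection[OF \<open>A + (- z) \<cdot>\<^sub>m 1\<^sub>m n \<in> carrier_mat n n\<close>]
      mem_Collect_eq
    by (metis orthogonal_projection_mat_def)
qed

section \<open>Hermitian pencils without real eigenvalues\<close>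

text \<open>Induction on \<open>i + j\<close>: by triangularity and the induction hypothesis each
  side at \<open>(i, j)\<close> reduces to one term, \<open>cnj (T $$ (i, i)) * M $$ (i, j)\<close>
  and \<open>M $$ (i, j) * T $$ (j, j)\<close>, whose diagonal factors differ by
  \<open>sep\<close>.\<close>

lemma triangular_sylvester_eq_0:
  fixes T M :: "complex mat"
  assumes T: "T \<in> carrier_mat k k" "upper_triangular T"
    and sep: "\<And>i j. i < k \<Longrightarrow> j < k \<Longrightarrow> T $$ (i, i) \<noteq> cnj (T $$ (j, j))"
    and M: "M \<in> carrier_mat k k"
    and eq: "mat_adjoint T * M = M * T"
  shows "M = 0\<^sub>m k k"
proof -
  have "M $$ (i, j) = 0" if "i < k" "j < k" for i j
    using that
  proof (induction "i + j" arbitrary: i j rule: less_induct)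
    case less
    have low: "T $$ (a, b) = 0" if "b < a" "a < k" for a b
      using T that by (auto simp: upper_triangular_def)
    have "(mat_adjoint T * M) $$ (i, j) = (\<Sum>l<k. cnj (T $$ (l, i)) * M $$ (l, j))"
      using T(1) M less.prems by (simp add: index_mult_mat_sum del: index_mult_mat(1))
    also have "\<dots> = (\<Sum>l<k. if l = i then cnj (T $$ (i, i)) * M $$ (i, j) else 0)"
    proof (rule sum.cong[OF refl])
      fix l assume l: "l \<in> {..<k}"
      have "l < i \<Longrightarrow> M $$ (l, j) = 0" using less.hyps[of l j] less.prems l by auto
      moreover have "i < l \<Longrightarrow> T $$ (l, i) = 0" using low l by auto
      ultimately show "cnj (T $$ (l, i)) * M $$ (l, j) =
          (if l = i then cnj (T $$ (i, i)) * M $$ (i, j) else 0)"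
        by (cases l i rule: linorder_cases) auto
    qed
    also have "\<dots> = cnj (T $$ (i, i)) * M $$ (i, j)" using less.prems by simp
    finally have l: "(mat_adjoint T * M) $$ (i, j) = cnj (T $$ (i, i)) * M $$ (i, j)" .
    have "(M * T) $$ (i, j) = (\<Sum>l<k. M $$ (i, l) * T $$ (l, j))"
      using T(1) M less.prems by (simp add: index_mult_mat_sum del: index_mult_mat(1))
    also have "\<dots> = (\<Sum>l<k. if l = j then M $$ (i, j) * T $$ (j, j) else 0)"
    proof (rule sum.cong[OF refl])
      fix l assume l: "l \<in> {..<k}"
      have "l < j \<Longrightarrow> M $$ (i, l) = 0" using less.hyps[of i l] less.prems l by auto
      moreover have "j < l \<Longrightarrow> T $$ (l, j) = 0" using low l by auto
      ultimately show "M $$ (i, l) * T $$ (l, j) =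
          (if l = j then M $$ (i, j) * T $$ (j, j) else 0)"
        by (cases l j rule: linorder_cases) auto
    qed
    also have "\<dots> = M $$ (i, j) * T $$ (j, j)" using less.prems by simp
    finally have r: "(M * T) $$ (i, j) = M $$ (i, j) * T $$ (j, j)" .
    have "(T $$ (j, j) - cnj (T $$ (i, i))) * M $$ (i, j) = 0"
      using l r eq by (simp add: algebra_simps)
    thus ?case using sep[of j i] less.prems by auto
  qed
  thus ?thesis using M by (intro eq_matI) auto
qed

text \<open>One of the two open half planes contains at least \<open>k\<close> of the entries,
  counted with multiplicity. With these listed first, the first \<open>k\<close> imaginary parts
  share a sign, which conjugation reverses.\<close>

lemma nonreal_half_plane_reordering:
  assumes "length es = 2 * k" "\<And>e. e \<in> set es \<Longrightarrow> Im e \<noteq> 0"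
  obtains es' where "mset es' = mset es"
    "\<And>i j. i < k \<Longrightarrow> j < k \<Longrightarrow> es' ! i \<noteq> cnj (es' ! j)"
proof -
  let ?p = "filter (\<lambda>e. Im e > 0) es" and ?q = "filter (\<lambda>e. \<not> Im e > 0) es"
  have len: "length ?p + length ?q = 2 * k"
    using assms(1) sum_length_filter_compl[of "\<lambda>e. Im e > 0" es] by simp
  have ms: "mset (?p @ ?q) = mset es" "mset (?q @ ?p) = mset es"
    by (simp_all add: union_commute)
  show thesis
  proof (cases "k \<le> length ?p")
    case True
    have pos: "Im ((?p @ ?q) ! i) > 0" if "i < k" for i
    proof -
      have "?p ! i \<in> set ?p" using that True by (intro nth_mem) linarith
      thus ?thesis using that True by (simp add: nth_append)
    qed
    have "(?p @ ?q) ! i \<noteq> cnj ((?p @ ?q) ! j)" if "i < k" "j < k" for i j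
    proof
      assume "(?p @ ?q) ! i = cnj ((?p @ ?q) ! j)"
      from arg_cong[OF this, of Im] pos[OF that(1)] pos[OF that(2)] show False
        unfolding cnj.sel by linarith
    qed
    with ms(1) show thesis by (rule that)
  next
    case False
    hence lq: "k \<le> length ?q" using len by linarith
    have neg: "Im ((?q @ ?p) ! i) < 0" if "i < k" for i
    proof -
      have "?q ! i \<in> set ?q" using that lq by (intro nth_mem) linarith
      hence "?q ! i \<in> set es" "\<not> Im (?q ! i) > 0" by simp_all
      hence "Im (?q ! i) < 0" using assms(2)[of "?q ! i"] by linarith
      thus ?thesis using that lq by (simp add: nth_append)
    qed
    have "(?q @ ?p) ! i \<noteq> cnj ((?q @ ?p) ! j)" if "i < k" "j < k" for i j
    proof
      assume "(?q @ ?p) ! i = cnj ((?q @ ?p) ! j)"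
      from arg_cong[OF this, of Im] neg[OF that(1)] neg[OF that(2)] show False
        unfolding cnj.sel by linarith
    qed
    with ms(2) show thesis by (rule that)
  qed
qed

lemma det_nonzero_inverse:
  fixes A :: "'a :: field mat"
  assumes A: "A \<in> carrier_mat n n" and "det A \<noteq> 0"
  obtains B where "B \<in> carrier_mat n n" "B * A = 1\<^sub>m n" "A * B = 1\<^sub>m n"
  using injective_mat_inverse[OF A] mult_col_mat_eq_0_iff[OF A] assms(2) by metis

lemma eigenvalue_col_matE:
  fixes N :: "'a :: field mat"
  assumes N: "N \<in> carrier_mat n n" and "poly (char_poly N) e = 0"
  obtains X where "X \<in> carrier_mat n 1" "X \<noteq> 0\<^sub>m n 1" "N * X = e \<cdot>\<^sub>m X"
proof -
  have c: "char_matrix N e \<in> carrier_mat n n" using N by (simp add: char_matrix_def)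
  have "det (char_matrix N e) = 0"
    using assms eigenvalue_root_char_poly[OF N] eigenvalue_det[OF N] by simp
  then obtain X where X: "X \<in> carrier_mat n 1" "X \<noteq> 0\<^sub>m n 1" "char_matrix N e * X = 0\<^sub>m n 1"
    using mult_col_mat_eq_0_iff[OF c] by blast
  have "char_matrix N e * X = N * X + (- e) \<cdot>\<^sub>m X"
    using N X(1) by (simp add: char_matrix_def mat_ring_simps)
  hence eq: "N * X + (- e) \<cdot>\<^sub>m X = 0\<^sub>m n 1" using X(3) by simp
  have "N * X = e \<cdot>\<^sub>m X"
  proof (rule eq_matI)
    fix i j assume "i < dim_row (e \<cdot>\<^sub>m X)" "j < dim_col (e \<cdot>\<^sub>m X)"
    moreover have "(N * X + (- e) \<cdot>\<^sub>m X) $$ (i, j) = 0\<^sub>m n 1 $$ (i, j)" unfolding eq ..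
    ultimately show "(N * X) $$ (i, j) = (e \<cdot>\<^sub>m X) $$ (i, j)"
      using X(1) N by (simp del: index_mult_mat(1))
  qed (use X(1) N in auto)
  with X show thesis using that by blast
qed

text \<open>An eigenvector of \<open>G' * H\<close> for a real eigenvalue would contradict
  \<open>nonreal\<close>, so the reordering applies to the roots of the characteristic polynomial.
  On the resulting subspace the Gram matrix of \<open>H\<close> is \<open>M * T\<close>, and its
  self-adjointness is the equation that forces \<open>M = 0\<close>.\<close>

lemma pencil_isotropic:
  fixes H G :: "complex mat"
  assumes H: "H \<in> carrier_mat (2 * k) (2 * k)" "mat_adjoint H = H"
    and G: "G \<in> carrier_mat (2 * k) (2 * k)" "mat_adjoint G = G" "det G \<noteq> 0"
    and nonreal: "\<And>e X. Im e = 0 \<Longrightarrow> X \<in> carrier_mat (2 * k) 1 \<Longrightarrow> H * X = e \<cdot>\<^sub>m (G * X) \<Longrightarrow>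
      X = 0\<^sub>m (2 * k) 1"
  shows "isotropic (2 * k) k (H + \<i> \<cdot>\<^sub>m G)"
proof -
  let ?m = "2 * k"
  obtain G' where G': "G' \<in> carrier_mat ?m ?m" "G' * G = 1\<^sub>m ?m" "G * G' = 1\<^sub>m ?m"
    using det_nonzero_inverse[OF G(1,3)] .
  define N where "N = G' * H"
  have N: "N \<in> carrier_mat ?m ?m" unfolding N_def using G' H by simp
  have "G * N = G * G' * H" unfolding N_def using G'(1) G(1) H(1) by (simp add: mult_assoc_dim)
  also have "\<dots> = H" unfolding G'(3) using H by simp
  finally have GN: "G * N = H" .
  obtain es where es: "char_poly N = (\<Prod>a\<leftarrow>es. [:- a, 1:])" "length es = ?m"
    using char_poly_factorized[OF N] by blast
  have "Im e \<noteq> 0" if "e \<in> set es" for e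
  proof
    assume e: "Im e = 0"
    have "poly (char_poly N) e = 0"
      unfolding es(1) poly_prod_list using that by (auto simp: prod_list_zero_iff)
    then obtain X where X: "X \<in> carrier_mat ?m 1" "X \<noteq> 0\<^sub>m ?m 1" "N * X = e \<cdot>\<^sub>m X"
      using eigenvalue_col_matE[OF N] by metis
    have "H * X = G * (N * X)" unfolding GN[symmetric] using G N X(1) by (simp add: mult_assoc_dim)
    also have "\<dots> = e \<cdot>\<^sub>m (G * X)" unfolding X(3) using G X(1) by (simp add: mult_smult_dim)
    finally show False using nonreal[OF e X(1)] X(2) by blast
  qed
  then obtain es' where es': "mset es' = mset es"
    and sep: "\<And>i j. i < k \<Longrightarrow> j < k \<Longrightarrow> es' ! i \<noteq> cnj (es' ! j)"
    using nonreal_half_plane_reordering[OF es(2)] by metis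
  have cp: "char_poly N = (\<Prod>a\<leftarrow>es'. [:- a, 1:])"
    unfolding es(1) by (metis es' mset_map prod_mset_prod_list)
  \<comment> \<open>The Schur form carries the eigenvalues on its diagonal in the order of the given
    list, so \<open>sep\<close> governs the first \<open>k\<close> diagonal entries.\<close>
  obtain B P Q where "schur_decomposition N es' = (B, P, Q)" by (metis prod_cases3)
  from schur_decomposition[OF N cp this]
  have sim: "similar_mat_wit N B P Q" and ut: "upper_triangular B" and dB: "diag_mat B = es'" by auto
  have B: "B \<in> carrier_mat ?m ?m" and P: "P \<in> carrier_mat ?m ?m" and Q: "Q \<in> carrier_mat ?m ?m"
    and QP: "Q * P = 1\<^sub>m ?m" and NPBQ: "N = P * B * Q"
    using sim N unfolding similar_mat_wit_def Let_def by auto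
  \<comment> \<open>\<open>E\<close> includes the first \<open>k\<close> coordinates and
    \<open>T\<close> is the leading block of \<open>B\<close>; since \<open>B\<close> is upper
    triangular, the range of \<open>E\<close> is invariant under \<open>B\<close>.\<close>
  define E where "E = mat ?m k (\<lambda>(i, j). if i = j then 1 else 0 :: complex)"
  define T where "T = mat k k (\<lambda>ij. B $$ ij)"
  have E: "E \<in> carrier_mat ?m k" and T: "T \<in> carrier_mat k k" unfolding E_def T_def by auto
  have EE: "mat_adjoint E * E = 1\<^sub>m k"
  proof (rule eq_matI)
    fix i j assume ij: "i < dim_row (1\<^sub>m k :: complex mat)" "j < dim_col (1\<^sub>m k :: complex mat)"
    have "(mat_adjoint E * E) $$ (i, j) = (\<Sum>l<?m. cnj (E $$ (l, i)) * E $$ (l, j))"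
      using ij E by (simp add: index_mult_mat_sum del: index_mult_mat(1))
    also have "\<dots> = (\<Sum>l<?m. if l = i then E $$ (i, j) else 0)"
      using ij by (intro sum.cong) (auto simp: E_def)
    also have "\<dots> = 1\<^sub>m k $$ (i, j)" using ij by (simp add: E_def)
    finally show "(mat_adjoint E * E) $$ (i, j) = 1\<^sub>m k $$ (i, j)" .
  qed (use E in auto)
  have BE: "B * E = E * T"
  proof (rule eq_matI)
    fix i j assume "i < dim_row (E * T)" "j < dim_col (E * T)"
    hence ij: "i < ?m" "j < k" using E T by auto
    have "(B * E) $$ (i, j) = (\<Sum>l<?m. B $$ (i, l) * E $$ (l, j))"
      using ij E B by (simp add: index_mult_mat_sum del: index_mult_mat(1))
    also have "\<dots> = (\<Sum>l<?m. if l = j then B $$ (i, j) else 0)"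
      using ij by (intro sum.cong) (auto simp: E_def)
    also have "\<dots> = B $$ (i, j)" using ij by simp
    \<comment> \<open>If \<open>i\<close> is at least \<open>k\<close>, the sum has no nonzero term,
      and \<open>B $$ (i, j)\<close> is 0 too because \<open>j < k\<close>.\<close>
    also have "\<dots> = (\<Sum>l<k. if l = i then B $$ (i, j) else 0)"
      using ij ut B by (auto simp: upper_triangular_def)
    also have "\<dots> = (\<Sum>l<k. E $$ (i, l) * T $$ (l, j))"
      using ij by (intro sum.cong) (auto simp: E_def T_def)
    also have "\<dots> = (E * T) $$ (i, j)"
      using ij E T by (simp add: index_mult_mat_sum del: index_mult_mat(1))
    finally show "(B * E) $$ (i, j) = (E * T) $$ (i, j)" .
  qed (use B E T in auto)
  \<comment> \<open>These are the first \<open>k\<close> columns of \<open>P\<close>; they span a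
    subspace invariant under \<open>N\<close>.\<close>
  define W where "W = P * E"
  have W: "W \<in> carrier_mat ?m k" unfolding W_def using P E by simp
  have left: "(mat_adjoint E * Q) * W = 1\<^sub>m k"
  proof -
    have "(mat_adjoint E * Q) * W = mat_adjoint E * (Q * P * E)"
      unfolding W_def using P Q E by (simp add: mult_assoc_dim)
    thus ?thesis unfolding QP using E EE by simp
  qed
  have "N * W = P * (B * (Q * P * E))"
    unfolding W_def NPBQ using P Q B E by (simp add: mult_assoc_dim)
  also have "\<dots> = W * T" unfolding QP W_def using P B E T BE by (simp add: mult_assoc_dim)
  finally have NW: "N * W = W * T" .
  define M where "M = mat_adjoint W * (G * W)"
  have M: "M \<in> carrier_mat k k" unfolding M_def using W G by (intro carrier_matI) simp_all
  have "mat_adjoint W * (H * W) = mat_adjoint W * (G * (N * W))"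
    unfolding GN[symmetric] using W G(1) N by (simp add: mult_assoc_dim)
  also have "\<dots> = M * T" unfolding NW M_def using W G(1) T by (simp add: mult_assoc_dim)
  finally have HW: "mat_adjoint W * (H * W) = M * T" .
  have aM: "mat_adjoint M = M"
    unfolding M_def using W G by (simp add: mat_adjoint_mult mult_assoc_dim)
  \<comment> \<open>By \<open>HW\<close> this is the Gram matrix of the self-adjoint
    \<open>H\<close>.\<close>
  have "mat_adjoint (M * T) = M * T"
    unfolding HW[symmetric] using W H by (simp add: mat_adjoint_mult mult_assoc_dim)
  hence syl: "mat_adjoint T * M = M * T" using M T aM by (simp add: mat_adjoint_mult)
  have T_diag: "T $$ (i, i) = es' ! i" if "i < k" for i
    using that B dB unfolding T_def by (auto simp: diag_mat_def)
  have "upper_triangular T" using ut B unfolding upper_triangular_def T_def by auto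
  hence M0: "M = 0\<^sub>m k k"
    using triangular_sylvester_eq_0[OF T _ _ M syl] T_diag sep by simp
  have "mat_adjoint W * (H + \<i> \<cdot>\<^sub>m G) * W = mat_adjoint W * (H * W) + \<i> \<cdot>\<^sub>m M"
    unfolding M_def using W H G by (simp add: mat_ring_simps)
  hence "mat_adjoint W * (H + \<i> \<cdot>\<^sub>m G) * W = 0\<^sub>m k k" unfolding HW M0 using T by simp
  with W left show ?thesis using E Q
    by (intro isotropicI[of W _ _ "mat_adjoint E * Q"] carrier_matI) simp_all
qed

section \<open>Compactness\<close>

text \<open>For an orthogonal projection the trace is the sum of the squared moduli of all entries,
  so each square is at most \<open>k\<close>. The bound \<open>1 + k\<close> avoids a square
  root.\<close>

lemma adjoint_idempotent_entry_bound:
  fixes P :: "complex mat"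
  assumes P: "P \<in> carrier_mat n n" "P * P = P" "mat_adjoint P = P" "mat_trace P = of_nat k"
    and ij: "i < n" "j < n"
  shows "cmod (P $$ (i, j)) \<le> 1 + k"
proof -
  have "of_nat k = mat_trace (mat_adjoint P * P)" using P by simp
  also have "\<dots> = of_real (\<Sum>b<n. \<Sum>a<n. (cmod (P $$ (a, b)))\<^sup>2)"
    using P(1) by (simp add: mat_trace_def adjoint_mult_self_diag del: index_mult_mat(1))
  finally have k: "real k = (\<Sum>b<n. \<Sum>a<n. (cmod (P $$ (a, b)))\<^sup>2)"
    by (subst of_real_eq_iff[where 'a = complex, symmetric]) simp
  have "(cmod (P $$ (i, j)))\<^sup>2 \<le> (\<Sum>a<n. (cmod (P $$ (a, j)))\<^sup>2)"
    using ij by (intro member_le_sum) auto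
  also have "\<dots> \<le> real k"
    unfolding k using ij by (intro member_le_sum[of j]) (auto intro: sum_nonneg)
  also have "\<dots> \<le> (1 + real k)\<^sup>2" by (simp add: power2_eq_square algebra_simps)
  finally have "cmod (P $$ (i, j)) \<le> 1 + real k" by (rule power2_le_imp_le) simp
  thus ?thesis by simp
qed

text \<open>Bolzano-Weierstrass is applied to one index at a time, each time thinning the previous
  subsequence.\<close>

lemma bounded_family_convergent_subsequence:
  fixes f :: "nat \<Rightarrow> 'i \<Rightarrow> complex"
  assumes "finite I" "\<And>m x. x \<in> I \<Longrightarrow> cmod (f m x) \<le> b"
  shows "\<exists>r g. strict_mono r \<and> (\<forall>x\<in>I. (\<lambda>m. f (r m) x) \<longlonglongrightarrow> g x)"
  using assms
proof (induction I rule: finite_induct)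
  case empty
  show ?case using strict_mono_id by auto
next
  case (insert x I)
  have "\<exists>r g. strict_mono r \<and> (\<forall>x\<in>I. (\<lambda>m. f (r m) x) \<longlonglongrightarrow> g x)"
    using insert.IH insert.prems by simp
  then obtain r g where r: "strict_mono r" "\<And>y. y \<in> I \<Longrightarrow> (\<lambda>m. f (r m) y) \<longlonglongrightarrow> g y"
    by blast
  have "\<forall>m. cmod (f (r m) x) \<le> b" using insert.prems by simp
  then obtain r' :: "nat \<Rightarrow> nat" and z where r': "strict_mono r'"
    "\<forall>e>0. \<exists>N. \<forall>m\<ge>N. cmod (f (r (r' m)) x - z) < e"
    using Bolzano_Weierstrass_complex_disc[of "\<lambda>m. f (r m) x" b] by blast
  hence "(\<lambda>m. f (r (r' m)) x) \<longlonglongrightarrow> z" by (simp add: LIMSEQ_iff)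
  moreover have "(\<lambda>m. f (r (r' m)) y) \<longlonglongrightarrow> g y" if "y \<in> I" for y
    using LIMSEQ_subseq_LIMSEQ[OF r(2)[OF that] r'(1)] by (simp add: o_def)
  ultimately have "\<forall>y\<in>insert x I. (\<lambda>m. f ((r \<circ> r') m) y) \<longlonglongrightarrow> (g(x := z)) y"
    using insert.hyps(2) by auto
  with strict_mono_o[OF r(1) r'(1)] show ?case by blast
qed

text \<open>Bases of the isotropic subspaces need not converge, but the orthogonal projections have
  uniformly bounded entries. A subsequence converges entrywise, the defining equations pass to the
  limit, and the rank is kept because it is the trace.\<close>

lemma isotropic_closed:
  fixes B :: "complex mat" and Bs :: "nat \<Rightarrow> complex mat"
  assumes B: "B \<in> carrier_mat n n" and Bs: "\<And>m. Bs m \<in> carrier_mat n n"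
    and iso: "\<And>m. isotropic n k (Bs m)"
    and lim: "\<And>i j. i < n \<Longrightarrow> j < n \<Longrightarrow> (\<lambda>m. Bs m $$ (i, j)) \<longlonglongrightarrow> B $$ (i, j)"
  shows "isotropic n k B"
proof -
  have "\<forall>m. \<exists>P. orthogonal_projection_mat n P \<and> vec_space.rank n P = k \<and> P * Bs m * P = 0\<^sub>m n n"
    using iso isotropic_iff_projection[OF Bs] by blast
  then obtain Ps where Ps': "\<And>m. orthogonal_projection_mat n (Ps m)"
    "\<And>m. vec_space.rank n (Ps m) = k" and PBP: "\<And>m. Ps m * Bs m * Ps m = 0\<^sub>m n n"
    by metis
  have Ps: "Ps m \<in> carrier_mat n n" "Ps m * Ps m = Ps m" "mat_adjoint (Ps m) = Ps m"
    "mat_trace (Ps m) = of_nat k" for m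
    using Ps'[of m] idempotent_rank_eq_trace[of "Ps m" n]
    unfolding orthogonal_projection_mat_def by auto
  have "\<exists>r g. strict_mono r \<and> (\<forall>x\<in>{..<n} \<times> {..<n}. (\<lambda>m. Ps (r m) $$ x) \<longlonglongrightarrow> g x)"
    using adjoint_idempotent_entry_bound[OF Ps]
    by (intro bounded_family_convergent_subsequence[where b = "1 + real k"]) auto
  then obtain r g where r: "strict_mono r"
    and g: "\<And>x. x \<in> {..<n} \<times> {..<n} \<Longrightarrow> (\<lambda>m. Ps (r m) $$ x) \<longlonglongrightarrow> g x"
    by blast
  define P where "P = mat n n g"
  have P: "P \<in> carrier_mat n n" unfolding P_def by simp
  have limP: "(\<lambda>m. Ps (r m) $$ (i, j)) \<longlonglongrightarrow> P $$ (i, j)" if "i < n" "j < n" for i j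
    using g[of "(i, j)"] that by (simp add: P_def)
  have limB: "(\<lambda>m. Bs (r m) $$ (i, j)) \<longlonglongrightarrow> B $$ (i, j)" if "i < n" "j < n" for i j
    using LIMSEQ_subseq_LIMSEQ[OF lim[OF that] r] by (simp add: o_def)
  have limit_mult: "(\<lambda>m. (X m * Y m) $$ (i, j)) \<longlonglongrightarrow> (X' * Y') $$ (i, j)"
    if "\<And>m. X m \<in> carrier_mat n n" "\<And>m. Y m \<in> carrier_mat n n"
      "X' \<in> carrier_mat n n" "Y' \<in> carrier_mat n n"
      "\<And>i j. i < n \<Longrightarrow> j < n \<Longrightarrow> (\<lambda>m. X m $$ (i, j)) \<longlonglongrightarrow> X' $$ (i, j)"
      "\<And>i j. i < n \<Longrightarrow> j < n \<Longrightarrow> (\<lambda>m. Y m $$ (i, j)) \<longlonglongrightarrow> Y' $$ (i, j)" "i < n" "j < n"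
    for X Y :: "nat \<Rightarrow> complex mat" and X' Y' i j
  proof -
    have "(X m * Y m) $$ (i, j) = (\<Sum>l<n. X m $$ (i, l) * Y m $$ (l, j))" for m
      using that(1)[of m] that(2)[of m] that(7,8)
      by (simp add: index_mult_mat_sum del: index_mult_mat(1))
    moreover have "(X' * Y') $$ (i, j) = (\<Sum>l<n. X' $$ (i, l) * Y' $$ (l, j))"
      using that(3,4,7,8) by (simp add: index_mult_mat_sum del: index_mult_mat(1))
    moreover have "(\<lambda>m. \<Sum>l<n. X m $$ (i, l) * Y m $$ (l, j)) \<longlonglongrightarrow>
        (\<Sum>l<n. X' $$ (i, l) * Y' $$ (l, j))"
      using that by (intro tendsto_sum tendsto_mult) auto
    ultimately show ?thesis by simp
  qed
  have idem: "P * P = P"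
  proof (rule eq_matI)
    fix i j assume "i < dim_row P" "j < dim_col P"
    hence ij: "i < n" "j < n" using P by auto
    have "(\<lambda>m. Ps (r m) $$ (i, j)) \<longlonglongrightarrow> (P * P) $$ (i, j)"
      using limit_mult[of "\<lambda>m. Ps (r m)" "\<lambda>m. Ps (r m)" P P i j] Ps P limP ij by simp
    thus "(P * P) $$ (i, j) = P $$ (i, j)" using limP[OF ij] LIMSEQ_unique by blast
  qed (use P in auto)
  have sa: "mat_adjoint P = P"
  proof (rule eq_matI)
    fix i j assume "i < dim_row P" "j < dim_col P"
    hence ij: "i < n" "j < n" using P by auto
    have "cnj (Ps m $$ (j, i)) = Ps m $$ (i, j)" for m
      using arg_cong[OF Ps(3)[of m], of "\<lambda>X. X $$ (i, j)"] ij Ps(1)[of m] by simp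
    hence "(\<lambda>m. Ps (r m) $$ (i, j)) \<longlonglongrightarrow> cnj (P $$ (j, i))"
      using tendsto_cnj[OF limP[OF ij(2,1)]] by simp
    thus "mat_adjoint P $$ (i, j) = P $$ (i, j)"
      using limP[OF ij] LIMSEQ_unique ij P by fastforce
  qed (use P in auto)
  have "(\<lambda>m. mat_trace (Ps (r m))) \<longlonglongrightarrow> mat_trace P"
  proof -
    have "mat_trace (Ps m) = (\<Sum>i<n. Ps m $$ (i, i))" for m
      using Ps(1)[of m] by (simp add: mat_trace_def)
    moreover have "mat_trace P = (\<Sum>i<n. P $$ (i, i))" using P by (simp add: mat_trace_def)
    ultimately show ?thesis using limP by (auto intro!: tendsto_sum)
  qed
  hence "mat_trace P = of_nat k" using Ps(4) by (simp add: LIMSEQ_const_iff)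
  hence rank: "vec_space.rank n P = k" using idempotent_rank_eq_trace[OF P idem] by simp
  have "P * B * P = 0\<^sub>m n n"
  proof (rule eq_matI)
    fix i j assume "i < dim_row (0\<^sub>m n n :: complex mat)" "j < dim_col (0\<^sub>m n n :: complex mat)"
    hence ij: "i < n" "j < n" by auto
    have "(\<lambda>m. (Ps (r m) * Bs (r m)) $$ (i, j)) \<longlonglongrightarrow> (P * B) $$ (i, j)"
      if "i < n" "j < n" for i j
      using limit_mult[of "\<lambda>m. Ps (r m)" "\<lambda>m. Bs (r m)" P B i j] Ps(1) Bs P B limP limB that by blast
    hence "(\<lambda>m. (Ps (r m) * Bs (r m) * Ps (r m)) $$ (i, j)) \<longlonglongrightarrow> (P * B * P) $$ (i, j)"
      using limit_mult[of "\<lambda>m. Ps (r m) * Bs (r m)" "\<lambda>m. Ps (r m)" "P * B" P i j]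
        Ps(1) Bs P B limP ij by (meson mult_carrier_mat)
    thus "(P * B * P) $$ (i, j) = 0\<^sub>m n n $$ (i, j)"
      unfolding PBP using ij by (simp add: LIMSEQ_const_iff del: index_mult_mat(1))
  qed (use P in auto)
  thus ?thesis
    unfolding isotropic_iff_projection[OF B] orthogonal_projection_mat_def
    using P idem sa rank by blast
qed

section \<open>Forms that are definite on two complementary subspaces\<close>

text \<open>Since \<open>J\<close> is an involution, \<open>G + e J\<close> applied to
  \<open>X\<close> equals \<open>G J + e\<close> applied to \<open>J * X\<close>, so a singular
  perturbation makes \<open>- e\<close> an eigenvalue of \<open>G * J\<close>. There are finitely
  many of these, and \<open>d\<close> does not exceed the modulus of any nonzero one.\<close>

lemma small_perturbation_det_nonzero:
  fixes G J :: "complex mat"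
  assumes G: "G \<in> carrier_mat m m" and J: "J \<in> carrier_mat m m" "J * J = 1\<^sub>m m"
  obtains d :: real where "d > 0" "\<And>e. 0 < e \<Longrightarrow> e < d \<Longrightarrow> det (G + of_real e \<cdot>\<^sub>m J) \<noteq> 0"
proof -
  have GJ: "G * J \<in> carrier_mat m m" using G J by simp
  \<comment> \<open>The root 0 is left out because \<open>G\<close> itself may be singular.\<close>
  define R where "R = {z. poly (char_poly (G * J)) z = 0} - {0}"
  have "char_poly (G * J) \<noteq> 0" using degree_monic_char_poly[OF GJ] by auto
  hence fin: "finite R" unfolding R_def using poly_roots_finite by blast
  \<comment> \<open>Inserting 1 keeps the minimum defined when \<open>R\<close> is empty.\<close>
  define d where "d = Min (insert 1 (cmod ` R))"
  have "d > 0" unfolding d_def using fin by (auto simp: R_def)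
  moreover have "det (G + of_real e \<cdot>\<^sub>m J) \<noteq> 0" if e: "0 < e" "e < d" for e
  proof
    have GeJ: "G + of_real e \<cdot>\<^sub>m J \<in> carrier_mat m m" using G J by simp
    assume "det (G + of_real e \<cdot>\<^sub>m J) = 0"
    then obtain X where X: "X \<in> carrier_mat m 1" "X \<noteq> 0\<^sub>m m 1"
      "(G + of_real e \<cdot>\<^sub>m J) * X = 0\<^sub>m m 1"
      using mult_col_mat_eq_0_iff[OF GeJ] by blast
    have "J * (J * X) = J * J * X" using J(1) X(1) by (simp add: mult_assoc_dim)
    hence JJX: "J * (J * X) = X" unfolding J(2) using X(1) by simp
    have cm: "char_matrix (G * J) (- of_real e) \<in> carrier_mat m m"
      by (rule char_matrix_closed[OF GJ])
    have "char_matrix (G * J) (- of_real e) * (J * X) = G * (J * (J * X)) + of_real e \<cdot>\<^sub>m (J * X)"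
      using G J(1) X(1) by (simp add: char_matrix_def mat_ring_simps)
    also have "\<dots> = (G + of_real e \<cdot>\<^sub>m J) * X"
      unfolding JJX using G J(1) X(1) by (simp add: mat_ring_simps)
    finally have "char_matrix (G * J) (- of_real e) * (J * X) = 0\<^sub>m m 1" using X(3) by simp
    moreover have "J * X \<noteq> 0\<^sub>m m 1"
      using JJX X(2) J(1) by (metis right_mult_zero_mat)
    moreover have "J * X \<in> carrier_mat m 1" using J X by simp
    ultimately have "det (char_matrix (G * J) (- of_real e)) = 0"
      unfolding mult_col_mat_eq_0_iff[OF cm] by blast
    hence "- of_real e \<in> R"
      unfolding R_def using e eigenvalue_root_char_poly[OF GJ] eigenvalue_det[OF GJ] by simp
    hence "cmod (- of_real e) \<in> insert 1 (cmod ` R)" by blast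
    hence "d \<le> cmod (- of_real e)" unfolding d_def using fin by (intro Min_le) auto
    thus False using e by simp
  qed
  ultimately show thesis using that by blast
qed

text \<open>As \<open>D * F + F * D\<close> is self-adjoint, \<open>mat_adjoint F\<close> yields the
  same matrix, so it comes from the Hermitian part \<open>H\<close> alone and
  \<open>D * G + G * D\<close> vanishes. A solution of \<open>H X = \<mu> G X\<close> with real
  \<open>\<mu>\<close> then makes the definite form vanish at \<open>X\<close>. \<open>J\<close>
  anticommutes with \<open>D\<close>, so adding a small real multiple of it makes \<open>G\<close>
  invertible and keeps this argument intact.\<close>

lemma lyapunov_isotropic:
  fixes D F J :: "complex mat" and k :: nat
  defines "m \<equiv> 2 * k"
  assumes D: "D \<in> carrier_mat m m" "mat_adjoint D = D"
    and J: "J \<in> carrier_mat m m" "mat_adjoint J = J" "J * J = 1\<^sub>m m"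
      "D * J + J * D = 0\<^sub>m m m"
    and F: "F \<in> carrier_mat m m"
    and sa: "mat_adjoint (D * F + F * D) = D * F + F * D"
    and definite: "\<And>X. X \<in> carrier_mat m 1 \<Longrightarrow> mat_adjoint X * ((D * F + F * D) * X) = 0\<^sub>m 1 1 \<Longrightarrow>
      X = 0\<^sub>m m 1"
  shows "isotropic m k F"
proof -
  define H where "H = (1/2) \<cdot>\<^sub>m F + (1/2) \<cdot>\<^sub>m mat_adjoint F"
  define G where "G = (- \<i>/2) \<cdot>\<^sub>m F + (\<i>/2) \<cdot>\<^sub>m mat_adjoint F"
  let ?S = "D * F + F * D"
  have H: "H \<in> carrier_mat m m" and G: "G \<in> carrier_mat m m" using F by (auto simp: H_def G_def)
  have aH: "mat_adjoint H = H" and aG: "mat_adjoint G = G"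
    using F by (auto simp: H_def G_def mat_adjoint_add mat_adjoint_smult intro!: eq_matI)
  have FHG: "H + \<i> \<cdot>\<^sub>m G = F"
    using F by (auto simp: H_def G_def algebra_simps intro!: eq_matI)
  have S: "?S \<in> carrier_mat m m" using D F by simp
  have aS: "D * mat_adjoint F + mat_adjoint F * D = ?S"
  proof -
    have "mat_adjoint ?S = mat_adjoint F * D + D * mat_adjoint F"
      using D F by (simp add: mat_adjoint_simps)
    moreover have "\<dots> = D * mat_adjoint F + mat_adjoint F * D"
      using D F by (intro comm_add_mat[of _ m m]) auto
    ultimately show ?thesis using sa by simp
  qed
  \<comment> \<open>The coefficients \<open>a\<close> and \<open>b\<close> add up to 1 for
    \<open>H\<close> and to 0 for \<open>G\<close>.\<close>
  have comb: "D * (a \<cdot>\<^sub>m F + b \<cdot>\<^sub>m mat_adjoint F) + (a \<cdot>\<^sub>m F + b \<cdot>\<^sub>m mat_adjoint F) * D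
    = (a + b) \<cdot>\<^sub>m ?S" for a b
  proof -
    have "D * (a \<cdot>\<^sub>m F + b \<cdot>\<^sub>m mat_adjoint F) + (a \<cdot>\<^sub>m F + b \<cdot>\<^sub>m mat_adjoint F) * D
      = a \<cdot>\<^sub>m ?S + b \<cdot>\<^sub>m (D * mat_adjoint F + mat_adjoint F * D)"
      using D(1) F
      by (intro eq_matI) (simp_all add: mat_ring_simps algebra_simps del: index_mult_mat(1))
    thus ?thesis unfolding aS using S by (simp add: add_smult_distrib_right_mat)
  qed
  have DH: "D * H + H * D = ?S" unfolding H_def comb by (intro eq_matI) simp_all
  have DG: "D * G + G * D = 0\<^sub>m m m" unfolding G_def comb using D F by (intro eq_matI) simp_all
  obtain d where d: "d > 0" "\<And>e. 0 < e \<Longrightarrow> e < d \<Longrightarrow> det (G + of_real e \<cdot>\<^sub>m J) \<noteq> 0"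
    using small_perturbation_det_nonzero[OF G J(1,3)] by blast
  have pert: "isotropic m k (H + \<i> \<cdot>\<^sub>m (G + of_real e \<cdot>\<^sub>m J))" if e: "0 < e" "e < d" for e
  proof -
    let ?G = "G + of_real e \<cdot>\<^sub>m J"
    have Ge: "?G \<in> carrier_mat m m" using G J by simp
    have aGe: "mat_adjoint ?G = ?G" using aG J(2) G J(1) by (simp add: mat_adjoint_simps)
    have "D * ?G + ?G * D = (D * G + G * D) + of_real e \<cdot>\<^sub>m (D * J + J * D)"
      using D(1) G J(1)
      by (intro eq_matI) (simp_all add: mat_ring_simps algebra_simps del: index_mult_mat(1))
    hence DGe: "D * ?G + ?G * D = 0\<^sub>m m m" unfolding DG J(4) by simp
    have "X = 0\<^sub>m m 1"
      if mu: "Im \<mu> = 0" and X: "X \<in> carrier_mat m 1" and eig: "H * X = \<mu> \<cdot>\<^sub>m (?G * X)" for \<mu> X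
    proof -
      have cnj_mu: "cnj \<mu> = \<mu>" using mu by (simp add: complex_eq_iff)
      \<comment> \<open>This is the adjoint of \<open>eig\<close>; the real \<open>\<mu>\<close> is
        unchanged by conjugation.\<close>
      have XH: "mat_adjoint X * H = \<mu> \<cdot>\<^sub>m (mat_adjoint X * ?G)"
      proof -
        have "mat_adjoint X * H = mat_adjoint (H * X)"
          using H X aH by (simp add: mat_adjoint_mult)
        also have "\<dots> = \<mu> \<cdot>\<^sub>m (mat_adjoint X * mat_adjoint ?G)"
          unfolding eig mat_adjoint_smult cnj_mu using Ge X by (subst mat_adjoint_mult) auto
        finally show ?thesis unfolding aGe .
      qed
      have "mat_adjoint X * ((D * H + H * D) * X)
          = mat_adjoint X * (D * (H * X)) + (mat_adjoint X * H) * (D * X)"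
        using H X D(1) by (simp add: mat_ring_simps)
      also have "\<dots> = \<mu> \<cdot>\<^sub>m (mat_adjoint X * (D * (?G * X)))
          + \<mu> \<cdot>\<^sub>m (mat_adjoint X * (?G * (D * X)))"
        unfolding eig XH using Ge J(1) X D(1) by (simp add: mult_assoc_dim mult_smult_dim)
      also have "\<dots> = \<mu> \<cdot>\<^sub>m (mat_adjoint X * ((D * ?G + ?G * D) * X))"
      proof -
        have "mat_adjoint X * ((D * ?G + ?G * D) * X) =
            mat_adjoint X * (D * (?G * X)) + mat_adjoint X * (?G * (D * X))"
          using Ge J(1) X D(1)
          by (subst add_mult_distrib_mat[of _ m m]) (auto simp: mult_add_distrib_dim mult_assoc_dim)
        thus ?thesis
          using J(1) X D(1)
          by (intro eq_matI) (simp_all add: distrib_left del: index_mult_mat(1))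
      qed
      also have "\<dots> = 0\<^sub>m 1 1" unfolding DGe using X by simp
      finally show ?thesis using definite[OF X] unfolding DH by blast
    qed
    thus ?thesis
      using pencil_isotropic[of H k ?G] H aH Ge aGe d(2)[OF e] unfolding m_def by blast
  qed
  \<comment> \<open>The shift by 2 makes already \<open>e 0 = d / 2\<close> smaller than
    \<open>d\<close>.\<close>
  define e where "e i = d / of_nat (i + 2)" for i
  have e: "0 < e i" "e i < d" for i
    using d(1) by (simp_all add: e_def field_simps add_pos_nonneg)
  have e0: "e \<longlonglongrightarrow> 0" unfolding e_def
    by (rule LIMSEQ_ignore_initial_segment[OF lim_const_over_n])
  have "isotropic m k (H + \<i> \<cdot>\<^sub>m G)"
  proof (rule isotropic_closed)
    show "isotropic m k (H + \<i> \<cdot>\<^sub>m (G + of_real (e i) \<cdot>\<^sub>m J))" for i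
      using pert e by blast
    fix i j assume ij: "i < m" "j < m"
    have "(\<lambda>a. H $$ (i, j) + \<i> * (G $$ (i, j) + of_real (e a) * J $$ (i, j)))
        \<longlonglongrightarrow> H $$ (i, j) + \<i> * (G $$ (i, j) + of_real 0 * J $$ (i, j))"
      using e0 by (intro tendsto_intros)
    thus "(\<lambda>a. (H + \<i> \<cdot>\<^sub>m (G + of_real (e a) \<cdot>\<^sub>m J)) $$ (i, j)) \<longlonglongrightarrow> (H + \<i> \<cdot>\<^sub>m G) $$ (i, j)"
      using ij H G J(1) by simp
  qed (use H G J in auto)
  thus ?thesis unfolding FHG .
qed

text \<open>Each diagonal entry combines the squared norms of a column of \<open>U\<close> and one
  of \<open>V\<close> with positive weights, so both norms vanish.\<close>

lemma sum_gram_eq_0: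
  fixes U V :: "complex mat"
  assumes "dim_col U = l" "dim_col V = l" "p > 0" "q > 0"
    and eq: "of_real p \<cdot>\<^sub>m (mat_adjoint U * U) + of_real q \<cdot>\<^sub>m (mat_adjoint V * V) = 0\<^sub>m l l"
  shows "U = 0\<^sub>m (dim_row U) l" "V = 0\<^sub>m (dim_row V) l"
proof -
  have zero: "(\<Sum>i<dim_row U. (cmod (U $$ (i, j)))\<^sup>2) = 0 \<and> (\<Sum>i<dim_row V. (cmod (V $$ (i, j)))\<^sup>2) = 0"
    if j: "j < l" for j
  proof -
    let ?u = "\<Sum>i<dim_row U. (cmod (U $$ (i, j)))\<^sup>2" and ?v = "\<Sum>i<dim_row V. (cmod (V $$ (i, j)))\<^sup>2"
    have "complex_of_real (p * ?u + q * ?v) =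
        (of_real p \<cdot>\<^sub>m (mat_adjoint U * U) + of_real q \<cdot>\<^sub>m (mat_adjoint V * V)) $$ (j, j)"
      using assms(1,2) j by (simp add: adjoint_mult_self_diag del: index_mult_mat(1))
    also have "\<dots> = of_real 0" unfolding eq using j by simp
    finally have s: "p * ?u + q * ?v = 0" unfolding of_real_eq_iff .
    have "p * ?u \<ge> 0" "q * ?v \<ge> 0" using assms(3,4) by (auto intro!: mult_nonneg_nonneg sum_nonneg)
    with s have "p * ?u = 0" "q * ?v = 0" by linarith+
    thus ?thesis using assms(3,4) by simp
  qed
  show "U = 0\<^sub>m (dim_row U) l" "V = 0\<^sub>m (dim_row V) l"
    using zero assms(1,2) by (auto intro!: eq_matI simp: sum_nonneg_eq_0_iff)
qed

text \<open>The form of \<open>C\<close> is pulled back along \<open>Z = S * E1 + T * E2\<close> to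
  the form \<open>F\<close> on vectors of length \<open>2 * k\<close>, to which the preceding
  criterion applies. A subspace \<open>W\<close> isotropic for \<open>F\<close> is then carried
  forward to \<open>Z * W\<close>; injectivity there follows from the opposite signs of the
  form.\<close>

lemma definite_pair_isotropic:
  fixes S T C :: "complex mat" and p q :: real
  assumes C: "C \<in> carrier_mat n n"
    and S: "S \<in> carrier_mat n k" "YS \<in> carrier_mat k n" "YS * S = 1\<^sub>m k"
    and T: "T \<in> carrier_mat n k" "YT \<in> carrier_mat k n" "YT * T = 1\<^sub>m k"
    and pq: "p > 0" "q > 0"
    and SCS: "mat_adjoint S * C * S = of_real p \<cdot>\<^sub>m (mat_adjoint S * S)"
    and TCT: "mat_adjoint T * C * T = of_real (- q) \<cdot>\<^sub>m (mat_adjoint T * T)"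
  shows "isotropic n k C"
proof -
  define m where "m = 2 * k"
  \<comment> \<open>\<open>E1\<close> and \<open>E2\<close> read off the two halves of a vector of
    length \<open>2 * k\<close>, \<open>D\<close> is 1 on the first half and -1 on the second, and
    \<open>J\<close> exchanges the halves.\<close>
  define E1 where "E1 = mat k m (\<lambda>(i, j). if j = i then 1 else 0 :: complex)"
  define E2 where "E2 = mat k m (\<lambda>(i, j). if j = k + i then 1 else 0 :: complex)"
  define D where "D = mat m m (\<lambda>(i, j). if i = j then if i < k then 1 else - 1 else 0 :: complex)"
  define J where "J = mat m m (\<lambda>(i, j). if i = j + k \<or> j = i + k then 1 else 0 :: complex)"
  have E1: "E1 \<in> carrier_mat k m" and E2: "E2 \<in> carrier_mat k m"
    and D: "D \<in> carrier_mat m m" and J: "J \<in> carrier_mat m m"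
    by (auto simp: E1_def E2_def D_def J_def)
  have aD: "mat_adjoint D = D" and aJ: "mat_adjoint J = J"
    by (rule eq_matI; auto simp: D_def J_def)+
  have E1D: "E1 * D = E1"
  proof (rule eq_matI)
    fix i j assume "i < dim_row E1" "j < dim_col E1"
    hence ij: "i < k" "j < m" using E1 by auto
    have "(E1 * D) $$ (i, j) = (\<Sum>l<m. E1 $$ (i, l) * D $$ (l, j))"
      using ij E1 D by (simp add: index_mult_mat_sum del: index_mult_mat(1))
    also have "\<dots> = (\<Sum>l<m. if l = i then E1 $$ (i, j) else 0)"
      using ij by (intro sum.cong) (auto simp: E1_def D_def)
    finally show "(E1 * D) $$ (i, j) = E1 $$ (i, j)" using ij by (simp add: m_def)
  qed (use E1 D in auto)
  have E2D: "E2 * D = (- 1) \<cdot>\<^sub>m E2"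
  proof (rule eq_matI)
    fix i j assume "i < dim_row ((- 1) \<cdot>\<^sub>m E2)" "j < dim_col ((- 1) \<cdot>\<^sub>m E2)"
    hence ij: "i < k" "j < m" using E2 by auto
    have "(E2 * D) $$ (i, j) = (\<Sum>l<m. E2 $$ (i, l) * D $$ (l, j))"
      using ij E2 D by (simp add: index_mult_mat_sum del: index_mult_mat(1))
    also have "\<dots> = (\<Sum>l<m. if l = k + i then - E2 $$ (i, j) else 0)"
      using ij by (intro sum.cong) (auto simp: E2_def D_def)
    finally show "(E2 * D) $$ (i, j) = ((- 1) \<cdot>\<^sub>m E2) $$ (i, j)" using ij E2 by (simp add: m_def)
  qed (use E2 D in auto)
  have JJ: "J * J = 1\<^sub>m m"
  proof (rule eq_matI)
    fix i j assume "i < dim_row (1\<^sub>m m :: complex mat)" "j < dim_col (1\<^sub>m m :: complex mat)"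
    hence ij: "i < m" "j < m" by auto
    \<comment> \<open>This is the position of the only nonzero entry in row \<open>i\<close> of
      \<open>J\<close>.\<close>
    define s where "s = (if i < k then i + k else i - k)"
    have s: "s < m" using ij by (auto simp: s_def m_def)
    have "(J * J) $$ (i, j) = (\<Sum>l<m. J $$ (i, l) * J $$ (l, j))"
      using ij J by (simp add: index_mult_mat_sum del: index_mult_mat(1))
    also have "\<dots> = (\<Sum>l<m. if l = s then if i = j then 1 else 0 else 0)"
      using ij by (intro sum.cong) (auto simp: J_def s_def m_def)
    finally show "(J * J) $$ (i, j) = 1\<^sub>m m $$ (i, j)" using ij s by simp
  qed (use J in auto)
  have DJ: "D * J + J * D = 0\<^sub>m m m"
  proof (rule eq_matI)
    fix i j assume "i < dim_row (0\<^sub>m m m :: complex mat)" "j < dim_col (0\<^sub>m m m :: complex mat)"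
    hence ij: "i < m" "j < m" by auto
    have "(D * J) $$ (i, j) = (\<Sum>l<m. D $$ (i, l) * J $$ (l, j))"
      using ij J D by (simp add: index_mult_mat_sum del: index_mult_mat(1))
    also have "\<dots> = (\<Sum>l<m. if l = i then D $$ (i, i) * J $$ (i, j) else 0)"
      using ij by (intro sum.cong) (auto simp: D_def)
    also have "\<dots> = D $$ (i, i) * J $$ (i, j)" using ij by simp
    finally have l: "(D * J) $$ (i, j) = D $$ (i, i) * J $$ (i, j)" .
    have "(J * D) $$ (i, j) = (\<Sum>l<m. J $$ (i, l) * D $$ (l, j))"
      using ij J D by (simp add: index_mult_mat_sum del: index_mult_mat(1))
    also have "\<dots> = (\<Sum>l<m. if l = j then J $$ (i, j) * D $$ (j, j) else 0)"
      using ij by (intro sum.cong) (auto simp: D_def)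
    also have "\<dots> = J $$ (i, j) * D $$ (j, j)" using ij by simp
    finally have r: "(J * D) $$ (i, j) = J $$ (i, j) * D $$ (j, j)" .
    \<comment> \<open>\<open>J\<close> is nonzero only between different halves, where the diagonal
      entries of \<open>D\<close> are opposite.\<close>
    have "(D * J + J * D) $$ (i, j) = (D * J) $$ (i, j) + (J * D) $$ (i, j)"
      using ij J D by simp
    thus "(D * J + J * D) $$ (i, j) = 0\<^sub>m m m $$ (i, j)"
      unfolding l r using ij by (auto simp: D_def J_def m_def)
  qed (use J D in auto)
  have E12: "X = 0\<^sub>m m 1" if X: "X \<in> carrier_mat m 1" "E1 * X = 0\<^sub>m k 1" "E2 * X = 0\<^sub>m k 1" for X
  proof (rule eq_matI)
    fix i j assume "i < dim_row (0\<^sub>m m 1 :: complex mat)" "j < dim_col (0\<^sub>m m 1 :: complex mat)"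
    hence ij: "i < m" "j = 0" by auto
    have 1: "(E1 * X) $$ (a, 0) = X $$ (a, 0)" if "a < k" for a
    proof -
      have "(E1 * X) $$ (a, 0) = (\<Sum>l<m. E1 $$ (a, l) * X $$ (l, 0))"
        using that E1 X(1) by (simp add: index_mult_mat_sum del: index_mult_mat(1))
      also have "\<dots> = (\<Sum>l<m. if l = a then X $$ (a, 0) else 0)"
        using that by (intro sum.cong) (auto simp: E1_def)
      finally show ?thesis using that by (simp add: m_def)
    qed
    have 2: "(E2 * X) $$ (a, 0) = X $$ (k + a, 0)" if "a < k" for a
    proof -
      have "(E2 * X) $$ (a, 0) = (\<Sum>l<m. E2 $$ (a, l) * X $$ (l, 0))"
        using that E2 X(1) by (simp add: index_mult_mat_sum del: index_mult_mat(1))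
      also have "\<dots> = (\<Sum>l<m. if l = k + a then X $$ (k + a, 0) else 0)"
        using that by (intro sum.cong) (auto simp: E2_def)
      finally show ?thesis using that by (simp add: m_def)
    qed
    have "X $$ (i, 0) = 0"
    proof (cases "i < k")
      case True
      thus ?thesis using 1[of i] X(2) by simp
    next
      case False
      hence "i - k < k" "k + (i - k) = i" using ij by (auto simp: m_def)
      thus ?thesis using 2[of "i - k"] X(3) by simp
    qed
    thus "X $$ (i, j) = 0\<^sub>m m 1 $$ (i, j)" using ij by simp
  qed (use X in auto)
  define S' where "S' = S * E1"
  define T' where "T' = T * E2"
  have S': "S' \<in> carrier_mat n m" and T': "T' \<in> carrier_mat n m"
    using S T E1 E2 by (auto simp: S'_def T'_def)
  have SD: "S' * D = S'" unfolding S'_def using S(1) E1 D by (simp add: mult_assoc_dim E1D)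
  have TD: "T' * D = (- 1) \<cdot>\<^sub>m T'"
    unfolding T'_def using T(1) E2 D by (simp add: mult_assoc_dim E2D mult_smult_dim)
  have inj: "X = 0\<^sub>m m 1" if X: "X \<in> carrier_mat m 1" "S' * X = 0\<^sub>m n 1" "T' * X = 0\<^sub>m n 1" for X
  proof (rule E12[OF X(1)])
    have "S * (E1 * X) = 0\<^sub>m n 1" "T * (E2 * X) = 0\<^sub>m n 1"
      using X S(1) T(1) E1 E2 unfolding S'_def T'_def by (simp_all add: mult_assoc_dim)
    moreover have "E1 * X \<in> carrier_mat k 1" "E2 * X \<in> carrier_mat k 1"
      using E1 E2 X(1) by simp_all
    ultimately show "E1 * X = 0\<^sub>m k 1" "E2 * X = 0\<^sub>m k 1"
      using mult_left_inverse_cancel[OF S] mult_left_inverse_cancel[OF T] by blast+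
  qed
  have SCS': "mat_adjoint S' * (C * S') = of_real p \<cdot>\<^sub>m (mat_adjoint S' * S')"
  proof -
    have "mat_adjoint S' * (C * S') = mat_adjoint E1 * (mat_adjoint S * C * S * E1)"
      unfolding S'_def using S(1) E1 C by (simp add: mat_adjoint_mult mult_assoc_dim)
    thus ?thesis unfolding SCS unfolding S'_def
      using S(1) E1 by (simp add: mat_adjoint_mult mult_assoc_dim mult_smult_dim)
  qed
  have TCT': "mat_adjoint T' * (C * T') = of_real (- q) \<cdot>\<^sub>m (mat_adjoint T' * T')"
  proof -
    have "mat_adjoint T' * (C * T') = mat_adjoint E2 * (mat_adjoint T * C * T * E2)"
      unfolding T'_def using T(1) E2 C by (simp add: mat_adjoint_mult mult_assoc_dim)
    thus ?thesis unfolding TCT unfolding T'_def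
      using T(1) E2 by (simp add: mat_adjoint_mult mult_assoc_dim mult_smult_dim)
  qed
  define Z where "Z = S' + T'"
  have Z: "Z \<in> carrier_mat n m" using S' T' by (simp add: Z_def)
  define F where "F = mat_adjoint Z * (C * Z)"
  have F: "F \<in> carrier_mat m m" unfolding F_def using Z C by (intro carrier_matI) simp_all
  have ZD: "Z * D = S' + (- 1) \<cdot>\<^sub>m T'"
    unfolding Z_def using S' T' D SD TD by (simp add: mat_ring_simps)
  have "D * mat_adjoint Z = mat_adjoint (Z * D)" using Z D aD by (simp add: mat_adjoint_mult)
  hence DZ: "D * mat_adjoint Z = mat_adjoint S' + (- 1) \<cdot>\<^sub>m mat_adjoint T'"
    unfolding ZD using S' T' by (simp add: mat_adjoint_simps)
  have "D * F + F * D = (D * mat_adjoint Z) * (C * Z) + mat_adjoint Z * (C * (Z * D))"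
    unfolding F_def using D C Z by (simp add: mult_assoc_dim)
  \<comment> \<open>The cross terms between \<open>S'\<close> and \<open>T'\<close> occur with
    opposite signs in the two summands and cancel.\<close>
  also have "\<dots> = 2 \<cdot>\<^sub>m (mat_adjoint S' * (C * S')) + (- 2) \<cdot>\<^sub>m (mat_adjoint T' * (C * T'))"
    unfolding DZ ZD unfolding Z_def using S' T' C
    by (intro eq_matI)
      (simp_all add: mat_ring_simps mat_adjoint_simps algebra_simps del: index_mult_mat(1))
  also have "\<dots> = of_real (2 * p) \<cdot>\<^sub>m (mat_adjoint S' * S') + of_real (2 * q) \<cdot>\<^sub>m (mat_adjoint T' * T')"
    unfolding SCS' TCT' using S' T' by (intro eq_matI) (simp_all del: index_mult_mat(1))
  finally have lyap: "D * F + F * D =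
    of_real (2 * p) \<cdot>\<^sub>m (mat_adjoint S' * S') + of_real (2 * q) \<cdot>\<^sub>m (mat_adjoint T' * T')" .
  have "isotropic m k F"
  proof (rule lyapunov_isotropic[of D k J F, folded m_def, OF D aD J aJ JJ DJ F])
    show "mat_adjoint (D * F + F * D) = D * F + F * D"
      unfolding lyap using S' T' by (simp add: mat_adjoint_simps)
    fix X assume X: "X \<in> carrier_mat m 1" and "mat_adjoint X * ((D * F + F * D) * X) = 0\<^sub>m 1 1"
    hence "of_real (2 * p) \<cdot>\<^sub>m (mat_adjoint (S' * X) * (S' * X)) +
        of_real (2 * q) \<cdot>\<^sub>m (mat_adjoint (T' * X) * (T' * X)) = 0\<^sub>m 1 1"
      unfolding lyap using S' T' X by (simp add: mat_ring_simps mat_adjoint_mult)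
    from sum_gram_eq_0[OF _ _ _ _ this] pq X S' T'
    show "X = 0\<^sub>m m 1" by (intro inj) simp_all
  qed
  then obtain W Y where W: "W \<in> carrier_mat m k" "Y \<in> carrier_mat k m" "Y * W = 1\<^sub>m k"
    "mat_adjoint W * F * W = 0\<^sub>m k k" by (rule isotropicE)
  show ?thesis
  proof (rule isotropic_injectiveI)
    show "Z * W \<in> carrier_mat n k" using Z W by simp
    have "mat_adjoint (Z * W) * C * (Z * W) = mat_adjoint W * F * W"
      unfolding F_def using Z W(1) C by (simp add: mat_adjoint_mult mult_assoc_dim)
    thus "mat_adjoint (Z * W) * C * (Z * W) = 0\<^sub>m k k" using W(4) by simp
    \<comment> \<open>If \<open>Z\<close> kills \<open>W * X\<close>, its two components are
      \<open>u\<close> and \<open>v = - u\<close>, where the form of \<open>C\<close> takes the same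
      value. This value is \<open>p\<close> times one squared norm and \<open>- q\<close> times the
      other, hence both norms are 0.\<close>
    fix X assume X: "X \<in> carrier_mat k 1" "Z * W * X = 0\<^sub>m n 1"
    define u where "u = S' * (W * X)"
    define v where "v = T' * (W * X)"
    have u: "u \<in> carrier_mat n 1" and v: "v \<in> carrier_mat n 1"
      using S' T' W X by (auto simp: u_def v_def)
    have uv: "u + v = 0\<^sub>m n 1"
      unfolding u_def v_def using X S' T' W(1) by (simp add: Z_def mat_ring_simps)
    have vu: "v = (- 1) \<cdot>\<^sub>m u"
    proof (rule eq_matI)
      fix i j assume "i < dim_row ((- 1) \<cdot>\<^sub>m u)" "j < dim_col ((- 1) \<cdot>\<^sub>m u)"
      moreover have "(u + v) $$ (i, j) = 0\<^sub>m n 1 $$ (i, j)" unfolding uv ..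
      ultimately show "v $$ (i, j) = ((- 1) \<cdot>\<^sub>m u) $$ (i, j)"
        using u v by (simp add: add_eq_0_iff)
    qed (use u v in auto)
    have uCu: "mat_adjoint u * (C * u) = of_real p \<cdot>\<^sub>m (mat_adjoint u * u)"
    proof -
      have "mat_adjoint u * (C * u) =
          mat_adjoint (W * X) * ((mat_adjoint S' * (C * S')) * (W * X))"
        unfolding u_def using S' C W(1) X(1) by (simp add: mat_adjoint_mult mult_assoc_dim)
      thus ?thesis unfolding SCS' unfolding u_def
        using S' W(1) X(1) by (simp add: mat_adjoint_mult mult_assoc_dim mult_smult_dim)
    qed
    have vCv: "mat_adjoint v * (C * v) = of_real (- q) \<cdot>\<^sub>m (mat_adjoint v * v)"
    proof -
      have "mat_adjoint v * (C * v) =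
          mat_adjoint (W * X) * ((mat_adjoint T' * (C * T')) * (W * X))"
        unfolding v_def using T' C W(1) X(1) by (simp add: mat_adjoint_mult mult_assoc_dim)
      thus ?thesis unfolding TCT' unfolding v_def
        using T' W(1) X(1) by (simp add: mat_adjoint_mult mult_assoc_dim mult_smult_dim)
    qed
    have "mat_adjoint v * (C * v) = mat_adjoint u * (C * u)"
      unfolding vu using u C
      by (intro eq_matI) (simp_all add: mat_adjoint_smult mult_smult_dim del: index_mult_mat(1))
    hence eq: "of_real p \<cdot>\<^sub>m (mat_adjoint u * u) = of_real (- q) \<cdot>\<^sub>m (mat_adjoint v * v)"
      using uCu vCv by simp
    have "of_real p \<cdot>\<^sub>m (mat_adjoint u * u) + of_real q \<cdot>\<^sub>m (mat_adjoint v * v) = 0\<^sub>m 1 1"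
      unfolding eq using v by (intro eq_matI) (simp_all del: index_mult_mat(1))
    from sum_gram_eq_0[OF _ _ pq this] u v have "u = 0\<^sub>m n 1" "v = 0\<^sub>m n 1" by auto
    hence "W * X = 0\<^sub>m m 1" using W(1) X(1) by (intro inj) (simp_all add: u_def v_def)
    thus "X = 0\<^sub>m k 1" using mult_left_inverse_cancel[OF W(1-3) X(1)] by blast
  qed
qed

section \<open>Segments between two points of the numerical range\<close>

theorem corollary2p3:
  fixes n k :: nat and A :: "complex mat"
  assumes "A \<in> carrier_mat n n"
    and "1 \<le> k" and "k \<le> n"
  shows "convex (rank_numerical_range n k A)"
proof (rule convexI)
  fix \<alpha> \<beta> :: complex and s t :: real
  assume \<alpha>: "\<alpha> \<in> rank_numerical_range n k A" and \<beta>: "\<beta> \<in> rank_numerical_range n k A"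
    and st: "0 \<le> s" "0 \<le> t" "s + t = 1"
  note A = assms(1)
  define z where "z = s *\<^sub>R \<alpha> + t *\<^sub>R \<beta>"
  have z: "z = of_real s * \<alpha> + of_real t * \<beta>" by (simp add: z_def scaleR_conv_of_real)
  show "z \<in> rank_numerical_range n k A"
  \<comment> \<open>In the degenerate cases \<open>z\<close> is an endpoint; otherwise
    \<open>\<alpha> - \<beta>\<close> is invertible and both weights are positive.\<close>
  proof (cases "s = 0 \<or> t = 0 \<or> \<alpha> = \<beta>")
    case True
    hence "z = \<alpha> \<or> z = \<beta>"
      using st scaleR_left_distrib[of s t \<beta>] by (auto simp: z_def)
    thus ?thesis using \<alpha> \<beta> by auto
  next
    case False
    \<comment> \<open>\<open>t\<close> is listed first because it becomes the factor of the form on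
      the space belonging to \<open>\<alpha>\<close>, in the role of \<open>p\<close>.\<close>
    hence st_pos: "0 < t" "0 < s" and ne: "\<alpha> - \<beta> \<noteq> 0" using st by auto
    obtain S YS where S: "S \<in> carrier_mat n k" "YS \<in> carrier_mat k n" "YS * S = 1\<^sub>m k"
      "mat_adjoint S * (A + (- \<alpha>) \<cdot>\<^sub>m 1\<^sub>m n) * S = 0\<^sub>m k k"
      using \<alpha> rank_numerical_range_iff_isotropic[OF A] by (metis isotropicE)
    obtain T YT where T: "T \<in> carrier_mat n k" "YT \<in> carrier_mat k n" "YT * T = 1\<^sub>m k"
      "mat_adjoint T * (A + (- \<beta>) \<cdot>\<^sub>m 1\<^sub>m n) * T = 0\<^sub>m k k"
      using \<beta> rank_numerical_range_iff_isotropic[OF A] by (metis isotropicE)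
    \<comment> \<open>This factor moves the segment into the real line: \<open>\<alpha> - z\<close>
      becomes \<open>t\<close> and \<open>\<beta> - z\<close> becomes \<open>- s\<close>.\<close>
    define c where "c = inverse (\<alpha> - \<beta>)"
    define C where "C = c \<cdot>\<^sub>m (A + (- z) \<cdot>\<^sub>m 1\<^sub>m n)"
    have C: "C \<in> carrier_mat n n" using A by (simp add: C_def)
    \<comment> \<open>\<open>C\<close> differs from a multiple of \<open>A\<close> shifted by
      \<open>\<gamma>\<close>, whose form vanishes on \<open>V\<close>, by a scalar matrix, so only
      a multiple of the Gram matrix remains.\<close>
    have compress: "mat_adjoint V * C * V = (c * (\<gamma> - z)) \<cdot>\<^sub>m (mat_adjoint V * V)"
      if V: "V \<in> carrier_mat n k" "mat_adjoint V * (A + (- \<gamma>) \<cdot>\<^sub>m 1\<^sub>m n) * V = 0\<^sub>m k k" for V \<gamma>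
    proof -
      have "C = c \<cdot>\<^sub>m (A + (- \<gamma>) \<cdot>\<^sub>m 1\<^sub>m n) + (c * (\<gamma> - z)) \<cdot>\<^sub>m 1\<^sub>m n"
        using A unfolding C_def by (intro eq_matI) (auto simp: algebra_simps)
      hence "mat_adjoint V * C * V = c \<cdot>\<^sub>m (mat_adjoint V * (A + (- \<gamma>) \<cdot>\<^sub>m 1\<^sub>m n) * V)
          + (c * (\<gamma> - z)) \<cdot>\<^sub>m (mat_adjoint V * V)"
        using V(1) A by (simp add: mult_add_distrib_dim add_mult_distrib_dim mult_smult_dim
            del: assoc_mult_mat)
      thus ?thesis unfolding V(2) using V(1) by (intro eq_matI) simp_all
    qed
    have s1: "s = 1 - t" using st by simp
    have "\<alpha> - z = of_real t * (\<alpha> - \<beta>)" "\<beta> - z = of_real (- s) * (\<alpha> - \<beta>)"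
      unfolding z s1 by (simp_all add: algebra_simps)
    hence "c * (\<alpha> - z) = of_real t" "c * (\<beta> - z) = of_real (- s)"
      unfolding c_def using ne by simp_all
    hence "isotropic n k C"
      using definite_pair_isotropic[OF C S(1-3) T(1-3) st_pos] compress[OF S(1,4)] compress[OF T(1,4)]
      by simp
    then obtain V Y where V: "V \<in> carrier_mat n k" "Y \<in> carrier_mat k n" "Y * V = 1\<^sub>m k"
      "mat_adjoint V * C * V = 0\<^sub>m k k" by (rule isotropicE)
    \<comment> \<open>Undoing the scaling keeps the isotropic subspace.\<close>
    have "A + (- z) \<cdot>\<^sub>m 1\<^sub>m n = (\<alpha> - \<beta>) \<cdot>\<^sub>m C"
      unfolding C_def c_def using ne A by (intro eq_matI) auto
    hence "mat_adjoint V * (A + (- z) \<cdot>\<^sub>m 1\<^sub>m n) * V = (\<alpha> - \<beta>) \<cdot>\<^sub>m (mat_adjoint V * C * V)"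
      using V(1) C by (simp add: mult_smult_dim)
    hence "mat_adjoint V * (A + (- z) \<cdot>\<^sub>m 1\<^sub>m n) * V = 0\<^sub>m k k" unfolding V(4) by simp
    thus ?thesis
      unfolding rank_numerical_range_iff_isotropic[OF A] using V(1-3) isotropicI by blast
  qed
qed

end
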